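(* For every trade-off parameter $s \in (0,1]$, define \[ \rho(s):=\frac{e^s}{s} \quad\text{and}\quad \chi(s):=\begin{cases} (e^s-1)/s, & 0< s < \ln 2, \\ \xi(s)/s, & \ln 2 \leq s \leq 1, \end{cases} \] where, for $s\in[\ln 2,1]$, $\xi(s)$ is the unique solution $\xi\in[1,e]$ of $\xi(2-\ln \xi)=e^s$. Then for every $s\in(0,1]$ there exists a randomized $\rho(s)$-robust $\chi(s)$-consistent online bidding algorithm (strategy). Moreover, the pair $(\rho(s),\chi(s))$ is Pareto-optimal: there is no $\rho'$-robust $\chi(s)$-consistent randomized strategy with $\rho'<\rho(s)$.
   Context: Online bidding: there is an unknown target $T>0$; a bidder submits strictly increasing positive bids until a bid of value at least $T$ is submitted; the cost is the sum of all submitted bids up to and including the first bid $\ge T$. A prediction $P>0$ of $T$ is given; by scale invariance it is normalized to $P=1$. Algorithms are modeled by strategies: a deterministic strategy is a bi-infinite sequence $b=(b_n)_{n\in\mathbb{Z}}$ with $0<\cdots<b_{-1}<b_0<b_1<\cdots$, and its cost on target $T>0$ is $\mathrm{cost}_b(T):=\sum_{n\le n_*} b_n$ where $n_*:=\min\{n\in\mathbb{Z}: b_n\ge T\}$. A randomized strategy $B$ is a probability distribution over deterministic strategies, and $\mathrm{cost}_B(T)$ denotes its expected cost. $B$ is $\chi$-consistent if $\mathrm{cost}_B(1)\le \chi$ and $\rho$-robust if $\mathrm{cost}_B(T)\le \rho T$ for every $T>0$. A pair $(\rho,\chi)$ is Pareto-optimal if there is a $\rho$-robust $\chi$-consistent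 strategy but no $\rho'$-robust $\chi$-consistent strategy for any $\rho'<\rho$. *)

theory Defs
  imports "HOL-Probability.Probability"
begin

definition strategy :: "(int \<Rightarrow> real) \<Rightarrow> bool" where
  "strategy b \<longleftrightarrow> (\<forall>n. 0 < b n) \<and> strict_mono b"

text \<open>Cost on target T: sum of all bids b n with n \<le> n_*, where n_* is the least index
  with b n_* \<ge> T.  Note that {n. \<forall>m<n. b m < T} = {..n_*}.  If no such least index
  exists the cost is taken to be infinite.\<close>
definition cost :: "(int \<Rightarrow> real) \<Rightarrow> real \<Rightarrow> ennreal" where
  "cost b T = (if \<exists>n. T \<le> b n \<and> (\<forall>m<n. b m < T)
     then \<integral>\<^sup>+ n. ennreal (b n) \<partial>(count_space {n. \<forall>m<n. b m < T})
     else \<infinity>)"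

definition randomized_strategy :: "(int \<Rightarrow> real) measure \<Rightarrow> bool" where
  "randomized_strategy M \<longleftrightarrow> prob_space M \<and> sets M = sets (Pi\<^sub>M UNIV (\<lambda>_. borel))
     \<and> (AE b in M. strategy b)"

definition exp_cost :: "(int \<Rightarrow> real) measure \<Rightarrow> real \<Rightarrow> ennreal" where
  "exp_cost M T = (\<integral>\<^sup>+ b. cost b T \<partial>M)"

definition robust :: "(int \<Rightarrow> real) measure \<Rightarrow> real \<Rightarrow> bool" where
  "robust M \<rho> \<longleftrightarrow> (\<forall>T>0. exp_cost M T \<le> ennreal (\<rho> * T))"

definition consistent :: "(int \<Rightarrow> real) measure \<Rightarrow> real \<Rightarrow> bool" where
  "consistent M c \<longleftrightarrow> exp_cost M 1 \<le> ennreal c"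

definition rho :: "real \<Rightarrow> real" where
  "rho s = exp s / s"

definition xi :: "real \<Rightarrow> real" where
  "xi s = (THE x. 1 \<le> x \<and> x \<le> exp 1 \<and> x * (2 - ln x) = exp s)"

definition chi :: "real \<Rightarrow> real" where
  "chi s = (if s < ln 2 then (exp s - 1) / s else xi s / s)"

end

theory Submission
  imports Defs
begin

text \<open>
  Upper bound. Bid \<open>\<beta> (n + U)\<close> for a single uniform \<open>U\<close> in \<open>(0,1)\<close> and an increasing curve \<open>\<beta>\<close>.
  The expected cost on T is the integral of \<open>\<beta>\<close> over all x with \<open>\<beta> (x - 1) < T\<close>, so it suffices for
  \<open>\<rho>\<close>-robustness that the integral of \<open>\<beta>\<close> up to \<open>t + 1\<close> is at most \<open>\<rho> * \<beta> t\<close>. The curve is 1 on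
  \<open>(0, p]\<close>, equals \<open>exp (s * (t - p))\<close> beyond p, and for \<open>t \<le> 0\<close> solves the advance equation
  \<open>\<beta>' t = \<beta> (t + 1) / \<rho>\<close>, starting from the smallest height at 0 for which the backward solution stays
  positive; this is the height for which its component along the eigenfunction \<open>exp (s * t)\<close> vanishes.
  The expected cost on 1 is \<open>\<rho> * \<beta> 0\<close>.

  Lower bound. For an arbitrary randomized strategy let \<open>h t\<close> be the least possible expected sum of
  bids of expected number t, counted from the target 1 (the integral up to t of the quantile function
  of the bids). Then \<open>h (t + 1) \<le> \<rho> * h' t\<close>. This forces h to grow at least like \<open>exp (s * t)\<close>, and the
  functional that annihilates all components of h except the one along \<open>exp (s * t)\<close> to be positive.
  Since \<open>h' \<ge> 1\<close> on \<open>[0, \<infinity>)\<close>, this bounds \<open>h 1\<close>, and hence the expected cost on 1, from below.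
\<close>

section \<open>Integral inequalities\<close>

lemma integral_le_increment_plus:
  fixes g h :: "real \<Rightarrow> real"
  assumes cont: "continuous_on {a..b} g" and "a \<le> b" "0 < e"
    and incr: "\<And>u v. a \<le> u \<Longrightarrow> u \<le> v \<Longrightarrow> v \<le> b \<Longrightarrow> (v - u) * g u \<le> h v - h u"
  shows "integral {a..b} g \<le> h b - h a + e * (b - a)"
proof -
  define P where "P u v \<longleftrightarrow>
    (a \<le> u \<longrightarrow> u \<le> v \<longrightarrow> v \<le> b \<longrightarrow> integral {u..v} g \<le> h v - h u + e * (v - u))" for u v
  have "P a b"
    using \<open>a \<le> b\<close>
  proof (induction rule: Bolzano)
    case (trans u v w)
    have "integral {u..w} g = integral {u..v} g + integral {v..w} g" if "a \<le> u" "w \<le> b"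
      using that trans.hyps
      by (intro Henstock_Kurzweil_Integration.integral_combine[symmetric]
          integrable_continuous_interval continuous_on_subset[OF cont]) auto
    then show ?case using trans unfolding P_def by (auto simp: algebra_simps)
  next
    case (local x)
    then obtain d where "0 < d" and close: "\<And>y. y \<in> {a..b} \<Longrightarrow> \<bar>y - x\<bar> < d \<Longrightarrow> \<bar>g y - g x\<bar> < e / 2"
      using cont \<open>0 < e\<close> unfolding continuous_on_iff dist_real_def
      by (metis atLeastAtMost_iff half_gt_zero)
    have "integral {u..v} g \<le> h v - h u + e * (v - u)"
      if interval: "u \<le> x" "x \<le> v" "v - u < d" "a \<le> u" "u \<le> v" "v \<le> b" for u v
    proof -
      have "g y \<le> g u + e" if "y \<in> {u..v}" for y
      proof -
        have "\<bar>g y - g x\<bar> < e / 2" "\<bar>g u - g x\<bar> < e / 2"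
          using interval that by (intro close; auto)+
        then show ?thesis by linarith
      qed
      then have "integral {u..v} g \<le> integral {u..v} (\<lambda>_. g u + e)"
        using interval by (intro integral_le integrable_continuous_interval
            continuous_on_subset[OF cont]) auto
      also have "\<dots> = (v - u) * g u + e * (v - u)"
        using interval by (simp add: algebra_simps)
      finally show ?thesis using incr[of u v] interval by simp
    qed
    then show ?case using \<open>0 < d\<close> unfolding P_def by blast
  qed
  then show ?thesis using \<open>a \<le> b\<close> by (simp add: P_def)
qed

lemma integral_le_increment:
  fixes g h :: "real \<Rightarrow> real"
  assumes "continuous_on {a..b} g" "a \<le> b"
    and "\<And>u v. a \<le> u \<Longrightarrow> u \<le> v \<Longrightarrow> v \<le> b \<Longrightarrow> (v - u) * g u \<le> h v - h u"
  shows "integral {a..b} g \<le> h b - h a"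
proof -
  have "integral {a..b} g \<le> h b - h a + e * (b - a)" if "0 < e" for e
    using assms that by (intro integral_le_increment_plus)
  then have "\<forall>\<^sub>F e in at_right 0. integral {a..b} g \<le> h b - h a + e * (b - a)"
    by (simp add: eventually_at_filter)
  moreover have "((\<lambda>e. h b - h a + e * (b - a)) \<longlongrightarrow> h b - h a + 0 * (b - a)) (at_right 0)"
    by (intro tendsto_intros)
  ultimately have "integral {a..b} g \<le> h b - h a + 0 * (b - a)"
    by (intro tendsto_lowerbound) auto
  then show ?thesis by simp
qed

text \<open>Integration by parts; an inequality, because h may increase faster than the integral of g.\<close>
lemma weighted_integral_le_increment:
  fixes g h w w' :: "real \<Rightarrow> real"
  assumes "a \<le> b"
    and cont: "continuous_on {a..b} g" "continuous_on {a..b} h" "continuous_on {a..b} w'"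
    and deriv: "\<And>u. u \<in> {a..b} \<Longrightarrow> (w has_real_derivative w' u) (at u within {a..b})"
    and decr: "\<And>u. u \<in> {a..b} \<Longrightarrow> w' u \<le> 0" and "0 \<le> w b"
    and incr: "\<And>u v. a \<le> u \<Longrightarrow> u \<le> v \<Longrightarrow> v \<le> b \<Longrightarrow> (v - u) * g u \<le> h v - h u"
  shows "integral {a..b} (\<lambda>u. w u * g u) + integral {a..b} (\<lambda>u. w' u * h u) \<le> w b * h b - w a * h a"
proof -
  define I where "I u = integral {a..u} g" for u
  have I_le: "I u \<le> h u - h a" if "u \<in> {a..b}" for u
    unfolding I_def using that
    by (intro integral_le_increment continuous_on_subset[OF cont(1)] incr) auto
  have I_derivative: "(I has_real_derivative g u) (at u within {a..b})" if "u \<in> {a..b}" for u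
    unfolding I_def using cont(1) that by (rule integral_has_real_derivative)
  have cont_I: "continuous_on {a..b} I" and cont_w: "continuous_on {a..b} w"
    using I_derivative deriv by (meson DERIV_continuous_on)+
  have "((\<lambda>u. w u * g u + w' u * I u) has_integral w b * I b - w a * I a) {a..b}"
    using \<open>a \<le> b\<close> by (intro fundamental_theorem_of_calculus)
      (auto simp flip: has_real_derivative_iff_has_vector_derivative
        intro!: derivative_eq_intros deriv I_derivative)
  then have by_parts:
    "integral {a..b} (\<lambda>u. w u * g u) + integral {a..b} (\<lambda>u. w' u * I u) = w b * I b"
    using cont cont_I cont_w
    by (subst Henstock_Kurzweil_Integration.integral_add[symmetric])
      (auto simp: I_def integral_unique intro!: integrable_continuous_interval continuous_intros)
  have "(w' has_integral w b - w a) {a..b}"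
    using \<open>a \<le> b\<close> deriv by (intro fundamental_theorem_of_calculus)
      (auto simp flip: has_real_derivative_iff_has_vector_derivative)
  then have "integral {a..b} (\<lambda>u. w' u * h u) - h a * (w b - w a)
      = integral {a..b} (\<lambda>u. w' u * (h u - h a))"
    using cont
    by (subst right_diff_distrib, subst Henstock_Kurzweil_Integration.integral_diff)
      (auto simp: integral_unique intro!: integrable_continuous_interval continuous_intros)
  also have "\<dots> \<le> integral {a..b} (\<lambda>u. w' u * I u)"
    by (intro integral_le integrable_continuous_interval continuous_intros cont cont_I
        mult_left_mono_neg decr I_le)
  finally have "integral {a..b} (\<lambda>u. w u * g u) + integral {a..b} (\<lambda>u. w' u * h u)
    \<le> w b * I b + h a * (w b - w a)"
    using by_parts by simp
  also have "w b * I b \<le> w b * (h b - h a)"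
    using I_le \<open>a \<le> b\<close> \<open>0 \<le> w b\<close> by (intro mult_left_mono) auto
  finally show ?thesis by (simp add: algebra_simps)
qed

corollary exp_weighted_integral_le_increment:
  fixes g h :: "real \<Rightarrow> real"
  assumes "a \<le> b" "0 \<le> c" "continuous_on {a..b} g" "continuous_on {a..b} h"
    and "\<And>u v. a \<le> u \<Longrightarrow> u \<le> v \<Longrightarrow> v \<le> b \<Longrightarrow> (v - u) * g u \<le> h v - h u"
  shows "integral {a..b} (\<lambda>u. exp (- c * u) * g u)
    \<le> exp (- c * b) * h b - exp (- c * a) * h a + c * integral {a..b} (\<lambda>u. exp (- c * u) * h u)"
proof -
  have "integral {a..b} (\<lambda>u. exp (- c * u) * g u) + integral {a..b} (\<lambda>u. - c * exp (- c * u) * h u)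
    \<le> exp (- c * b) * h b - exp (- c * a) * h a"
    using assms by (intro weighted_integral_le_increment)
      (auto intro!: derivative_eq_intros continuous_intros)
  then show ?thesis by (simp add: mult.assoc)
qed

lemma integral_exp_neg:
  fixes a b c :: real
  assumes "a \<le> b" "c \<noteq> 0"
  shows "integral {a..b} (\<lambda>u. exp (- c * u)) = (exp (- c * a) - exp (- c * b)) / c"
proof -
  have "((\<lambda>u. exp (- c * u)) has_integral - exp (- c * b) / c - - exp (- c * a) / c) {a..b}"
    using assms by (intro fundamental_theorem_of_calculus)
      (auto simp flip: has_real_derivative_iff_has_vector_derivative intro!: derivative_eq_intros)
  from integral_unique[OF this] show ?thesis by (simp add: diff_divide_distrib)
qed

section \<open>Functions with advanced growth\<close>

lemma mono_exp_weighted_if_linear_growth: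
  fixes h :: "real \<Rightarrow> real"
  assumes "0 \<le> c" and cont: "continuous_on UNIV h"
    and growth: "\<And>t t'. t \<le> t' \<Longrightarrow> (t' - t) * (c * h t) \<le> h t' - h t"
  shows "mono (\<lambda>t. exp (- c * t) * h t)"
proof (rule monoI)
  fix t t' :: real assume "t \<le> t'"
  have "continuous_on A h" for A
    using cont continuous_on_subset by blast
  then have "integral {t..t'} (\<lambda>u. exp (- c * u) * (c * h u))
    \<le> exp (- c * t') * h t' - exp (- c * t) * h t + c * integral {t..t'} (\<lambda>u. exp (- c * u) * h u)"
    using \<open>t \<le> t'\<close> \<open>0 \<le> c\<close> growth
    by (intro exp_weighted_integral_le_increment continuous_intros) auto
  moreover have "integral {t..t'} (\<lambda>u. exp (- c * u) * (c * h u))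
      = c * integral {t..t'} (\<lambda>u. exp (- c * u) * h u)"
    by (simp add: mult.left_commute)
  ultimately show "exp (- c * t) * h t \<le> exp (- c * t') * h t'"
    by simp
qed

lemma exp_rate_fixpoint:
  fixes c s :: real
  assumes "s \<le> 1" "c \<le> s" "s * exp (c - s) \<le> c" "0 < s"
  shows "c = s"
proof (rule ccontr)
  assume "c \<noteq> s"
  then have "c < s" using \<open>c \<le> s\<close> by simp
  then have "s * (1 + (c - s)) < s * exp (c - s)"
    using \<open>0 < s\<close> exp_minus_greater[of "s - c"] by simp
  then have "(1 - s) * (s - c) < 0"
    using assms(3) by (simp add: algebra_simps)
  then show False
    using \<open>c < s\<close> \<open>s \<le> 1\<close> by (simp add: mult_less_0_iff)
qed

locale advanced_growth =
  fixes h :: "real \<Rightarrow> real" and s r :: real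
  assumes s_bounds: "0 < s" "s \<le> 1"
    and r_gt: "s * exp (- s) < r"
    and pos: "\<And>t. 0 < h t"
    and continuous: "continuous_on UNIV h"
    and growth: "\<And>t t'. t \<le> t' \<Longrightarrow> (t' - t) * (r * h (t + 1)) \<le> h t' - h t"
begin

lemma r_pos: "0 < r"
  using r_gt s_bounds by (smt (verit) exp_gt_zero mult_pos_pos)

lemma continuous_on_h: "continuous_on A h"
  using continuous continuous_on_subset by blast

lemma mono_h: "mono h"
proof (rule monoI)
  fix t t' :: real assume "t \<le> t'"
  then have "0 \<le> (t' - t) * (r * h (t + 1))"
    using r_pos pos[of "t + 1"] by simp
  then show "h t \<le> h t'"
    using growth[OF \<open>t \<le> t'\<close>] by simp
qed

lemma mono_exp_weighted_improve:
  assumes "mono (\<lambda>t. exp (- c * t) * h t)"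
  shows "mono (\<lambda>t. exp (- (s * exp (c - s)) * t) * h t)"
proof (rule mono_exp_weighted_if_linear_growth[OF _ continuous])
  fix t t' :: real assume "t \<le> t'"
  have "exp c * h t = exp (c * (t + 1)) * (exp (- c * t) * h t)"
    by (simp add: distrib_left exp_add exp_minus)
  also have "\<dots> \<le> exp (c * (t + 1)) * (exp (- c * (t + 1)) * h (t + 1))"
    using monoD[OF assms, of t "t + 1"] by (intro mult_left_mono) auto
  also have "\<dots> = h (t + 1)"
    by (simp add: exp_minus)
  finally have "exp c * h t \<le> h (t + 1)" .
  then have "s * exp (- s) * (exp c * h t) \<le> r * h (t + 1)"
    using r_gt r_pos s_bounds pos[of t] by (intro mult_mono) auto
  also have "s * exp (- s) * (exp c * h t) = s * exp (c - s) * h t"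
    by (simp add: exp_diff exp_minus field_simps)
  finally have "(t' - t) * (s * exp (c - s) * h t) \<le> (t' - t) * (r * h (t + 1))"
    using \<open>t \<le> t'\<close> by (intro mult_left_mono) auto
  then show "(t' - t) * (s * exp (c - s) * h t) \<le> h t' - h t"
    using growth[OF \<open>t \<le> t'\<close>] by simp
qed (use s_bounds in simp)

definition scaled :: "real \<Rightarrow> real" where
  "scaled t = exp (- s * t) * h t"

text \<open>The rates of exponential growth up to s form a closed set that \<open>\<lambda>c. s * exp (c - s)\<close> maps into
  itself, so their supremum is the fixpoint s.\<close>
lemma mono_scaled: "mono scaled"
proof -
  define rates where
    "rates = {c. c \<le> s \<and> (\<forall>t t'. t \<le> t' \<longrightarrow> exp (- c * t) * h t \<le> exp (- c * t') * h t')}"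
  have rates_iff: "c \<in> rates \<longleftrightarrow> c \<le> s \<and> mono (\<lambda>t. exp (- c * t) * h t)" for c
    by (simp add: rates_def mono_def)
  have "closed rates"
    unfolding rates_def
    by (intro closed_Collect_conj closed_Collect_all closed_Collect_imp closed_Collect_le
        open_Collect_const continuous_intros)
  moreover have "0 \<in> rates"
    using mono_h s_bounds by (simp add: rates_iff)
  moreover have rates_bdd: "bdd_above rates"
    by (auto simp: rates_def bdd_above_def)
  ultimately have Sup_rates: "Sup rates \<in> rates"
    using closed_contains_Sup by blast
  then have "s * exp (Sup rates - s) \<le> s * 1"
    using s_bounds by (intro mult_left_mono) (auto simp: rates_iff)
  then have "s * exp (Sup rates - s) \<in> rates"
    using Sup_rates mono_exp_weighted_improve by (simp add: rates_iff)
  then have "s * exp (Sup rates - s) \<le> Sup rates"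
    using rates_bdd by (intro cSup_upper)
  then have "Sup rates = s"
    using Sup_rates s_bounds by (intro exp_rate_fixpoint) (auto simp: rates_iff)
  then show ?thesis
    using Sup_rates by (simp add: rates_iff scaled_def[abs_def])
qed

lemma scaled_pos: "0 < scaled t"
  by (simp add: scaled_def pos)

lemma scaled_integrable: "scaled integrable_on {a..b}"
  unfolding scaled_def by (intro integrable_continuous_interval continuous_intros continuous_on_h)

lemma integral_scaled_combine:
  "a \<le> b \<Longrightarrow> b \<le> c \<Longrightarrow> integral {a..b} scaled + integral {b..c} scaled = integral {a..c} scaled"
  by (intro Henstock_Kurzweil_Integration.integral_combine scaled_integrable)

lemma integral_scaled_bounds:
  "scaled t \<le> integral {t..t+1} scaled"
  "integral {t..t+1} scaled \<le> scaled (t + 1)"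
proof -
  have "integral {t..t+1} (\<lambda>_. scaled t) \<le> integral {t..t+1} scaled"
    by (intro integral_le scaled_integrable) (auto intro: monoD[OF mono_scaled])
  then show "scaled t \<le> integral {t..t+1} scaled" by simp
  have "integral {t..t+1} scaled \<le> integral {t..t+1} (\<lambda>_. scaled (t + 1))"
    by (intro integral_le scaled_integrable) (auto intro: monoD[OF mono_scaled])
  then show "integral {t..t+1} scaled \<le> scaled (t + 1)" by simp
qed

lemma weighted_integral_le_scaled_increment:
  assumes "t \<le> t'" "continuous_on {t..t'} g"
    and "\<And>u. t \<le> u \<Longrightarrow> u \<le> t' \<Longrightarrow> g u \<le> r * h (u + 1)"
  shows "integral {t..t'} (\<lambda>u. exp (- s * u) * g u)
    \<le> scaled t' - scaled t + s * integral {t..t'} scaled"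
  unfolding scaled_def
proof (intro exp_weighted_integral_le_increment continuous_on_h assms)
  fix u v assume "t \<le> u" "u \<le> v" "v \<le> t'"
  then have "(v - u) * g u \<le> (v - u) * (r * h (u + 1))"
    using assms by (intro mult_left_mono) auto
  also have "\<dots> \<le> h v - h u"
    using \<open>u \<le> v\<close> by (rule growth)
  finally show "(v - u) * g u \<le> h v - h u" .
qed (use s_bounds in simp)

text \<open>Constant in t when \<open>h' t = s * exp (- s) * h (t + 1)\<close>, and then 0 for every exponential
  solution other than \<open>exp (s * t)\<close>.\<close>
definition dominant_part :: "real \<Rightarrow> real" where
  "dominant_part t = scaled t - s * integral {t..t+1} scaled"

lemma dominant_part_increment:
  assumes "t \<le> t'"
  shows "(r * exp s - s) * integral {t+1..t'+1} scaled \<le> dominant_part t' - dominant_part t"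
proof -
  have "integral {t..t'} (\<lambda>u. exp (- s * u) * (r * h (u + 1)))
      = integral {t..t'} (\<lambda>u. r * exp s * scaled (u + 1))"
    by (simp add: scaled_def exp_add exp_minus exp_diff field_simps)
  also have "\<dots> = r * exp s * integral {t+1..t'+1} scaled"
    using integral_shift_real_ivl[of "t+1" 1 "t'+1" scaled] by simp
  finally have "r * exp s * integral {t+1..t'+1} scaled
      \<le> scaled t' - scaled t + s * integral {t..t'} scaled"
    using assms weighted_integral_le_scaled_increment[of t t' "\<lambda>u. r * h (u + 1)"]
    by (simp add: continuous_intros continuous_on_compose2[OF continuous])
  moreover have "integral {t..t+1} scaled + integral {t+1..t'+1} scaled
      = integral {t..t'} scaled + integral {t'..t'+1} scaled"
    using assms integral_scaled_combine[of t "t + 1" "t' + 1"]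
      integral_scaled_combine[of t t' "t' + 1"] by simp
  then have "s * integral {t..t+1} scaled + s * integral {t+1..t'+1} scaled
      = s * integral {t..t'} scaled + s * integral {t'..t'+1} scaled"
    by (metis distrib_left)
  ultimately show ?thesis
    unfolding dominant_part_def left_diff_distrib by linarith
qed

lemma rate_exp_gt: "s < r * exp s"
  using r_gt by (simp add: exp_minus field_simps)

lemma mono_dominant_part: "mono dominant_part"
proof (rule monoI)
  fix t t' :: real assume "t \<le> t'"
  have "0 \<le> integral {t+1..t'+1} scaled"
    using scaled_pos by (intro integral_nonneg scaled_integrable) (auto intro: less_imp_le)
  then have "0 \<le> (r * exp s - s) * integral {t+1..t'+1} scaled"
    using rate_exp_gt by simp
  then show "dominant_part t \<le> dominant_part t'"
    using dominant_part_increment[OF \<open>t \<le> t'\<close>] by simp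
qed

text \<open>If the dominant part were negative, the positive function \<open>scaled\<close> would decrease linearly
  to the left.\<close>
lemma dominant_part_nonneg: "0 \<le> dominant_part t"
proof (rule ccontr)
  assume "\<not> 0 \<le> dominant_part t"
  have step: "scaled u \<le> scaled (u + 1) + dominant_part t" if "u \<le> t" for u
  proof -
    have "s * integral {u..u+1} scaled \<le> 1 * scaled (u + 1)"
      using s_bounds integral_scaled_bounds[of u] scaled_pos[of u] by (intro mult_mono) auto
    then show ?thesis
      using monoD[OF mono_dominant_part that] by (simp add: dominant_part_def)
  qed
  have "scaled (t - real n) \<le> scaled t + real n * dominant_part t" for n
  proof (induction n)
    case (Suc n)
    then show ?case
      using step[of "t - real (Suc n)"] by (simp add: algebra_simps)
  qed simp
  moreover obtain n :: nat where "scaled t < real n * (- dominant_part t)"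
    using \<open>\<not> 0 \<le> dominant_part t\<close> ex_less_of_nat_mult[of "- dominant_part t" "scaled t"] by auto
  ultimately show False
    using scaled_pos[of "t - real n"] by (smt (verit) mult_minus_right)
qed

lemma dominant_part_pos: "0 < dominant_part t"
proof -
  have "0 < (r * exp s - s) * integral {t..t+1} scaled"
    using rate_exp_gt scaled_pos[of t] integral_scaled_bounds(1)[of t] by (intro mult_pos_pos) auto
  then show ?thesis
    using dominant_part_increment[of "t - 1" t] dominant_part_nonneg[of "t - 1"] by simp
qed

lemma exp_growth_after_one:
  assumes "0 \<le> u"
  shows "s * exp (- s) * (exp (s * u) * h 1) \<le> r * h (u + 1)"
proof -
  have "exp (s * u) * h 1 = exp (s * (u + 1)) * scaled 1"
    by (simp add: scaled_def distrib_left exp_add exp_minus)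
  also have "\<dots> \<le> exp (s * (u + 1)) * scaled (u + 1)"
    using assms by (intro mult_left_mono monoD[OF mono_scaled]) auto
  also have "\<dots> = h (u + 1)"
    by (simp add: scaled_def exp_minus)
  finally show ?thesis
    using r_gt s_bounds pos[of 1] r_pos by (intro mult_mono) auto
qed

text \<open>The dominant part at 0 bounds the integral of \<open>scaled\<close> over \<open>[0, 1]\<close>, on which h grows at least
  at rate 1 up to p and at least at rate \<open>s * exp (- s) * exp (s * u) * h 1\<close> from p on.\<close>
lemma value_at_one_gt:
  assumes slope: "\<And>t t'. 0 \<le> t \<Longrightarrow> t \<le> t' \<Longrightarrow> t' - t \<le> h t' - h t"
    and p_bounds: "0 \<le> p" "p \<le> 1"
  shows "exp s / s * (1 - exp (- s * p)) < h 1 * (1 - s * (1 - p))"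
proof -
  have "integral {0..p} (\<lambda>u. exp (- s * u) * 1) \<le> scaled p - scaled 0 + s * integral {0..p} scaled"
    using s_bounds p_bounds slope unfolding scaled_def
    by (intro exp_weighted_integral_le_increment continuous_on_h) auto
  then have before_p: "(1 - exp (- s * p)) / s \<le> scaled p - scaled 0 + s * integral {0..p} scaled"
    using integral_exp_neg[of 0 p s] s_bounds p_bounds by simp
  have "integral {p..1} (\<lambda>u. exp (- s * u) * (s * exp (- s) * (exp (s * u) * h 1)))
     \<le> scaled 1 - scaled p + s * integral {p..1} scaled"
    using p_bounds exp_growth_after_one
    by (intro weighted_integral_le_scaled_increment continuous_intros) auto
  moreover have "(\<lambda>u. exp (- s * u) * (s * exp (- s) * (exp (s * u) * h 1))) = (\<lambda>_. s * scaled 1)"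
    by (rule ext) (simp add: scaled_def exp_minus field_simps)
  moreover have "integral {p..1} (\<lambda>_. s * scaled 1) = (1 - p) * (s * scaled 1)"
    using p_bounds by simp
  ultimately have after_p:
    "(1 - p) * (s * scaled 1) \<le> scaled 1 - scaled p + s * integral {p..1} scaled"
    by (simp only:)
  have "s * integral {0..p} scaled + s * integral {p..1} scaled < scaled 0"
    using dominant_part_pos[of 0] integral_scaled_combine[OF p_bounds]
    by (simp add: dominant_part_def flip: distrib_left)
  then have "(1 - exp (- s * p)) / s < scaled 1 * (1 - s * (1 - p))"
    using before_p after_p by (simp add: algebra_simps)
  then have "exp s * ((1 - exp (- s * p)) / s) < exp s * (scaled 1 * (1 - s * (1 - p)))"
    by (intro mult_strict_left_mono) simp_all
  moreover have "exp s * scaled 1 = h 1"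
    by (simp add: scaled_def exp_minus)
  ultimately show ?thesis
    by (simp flip: mult.assoc)
qed

end

section \<open>Costs of deterministic strategies\<close>

definition stops_at :: "(int \<Rightarrow> real) \<Rightarrow> real \<Rightarrow> int \<Rightarrow> bool" where
  "stops_at b T n \<longleftrightarrow> T \<le> b n \<and> (\<forall>m<n. b m < T)"

definition first_bid :: "(int \<Rightarrow> real) \<Rightarrow> real \<Rightarrow> int" where
  "first_bid b T = (THE n. stops_at b T n)"

definition sum_below :: "(int \<Rightarrow> real) \<Rightarrow> int \<Rightarrow> real" where
  "sum_below b m = (\<Sum>k. b (m - 1 - int k))"

text \<open>Infinitely many bids precede the bid n; they are counted from the first one that reaches 1.\<close>
definition bid_count :: "(int \<Rightarrow> real) \<Rightarrow> int \<Rightarrow> real" where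
  "bid_count b n = real_of_int (n - first_bid b 1)"

lemma bid_count_Suc: "bid_count b (n + 1) = bid_count b n + 1"
  by (simp add: bid_count_def)

lemma stops_at_unique: "stops_at b T m \<Longrightarrow> stops_at b T n \<Longrightarrow> m = n"
  unfolding stops_at_def by (meson linorder_neqE not_less)

lemma first_bid_eq: "stops_at b T n \<Longrightarrow> first_bid b T = n"
  unfolding first_bid_def by (intro the_equality stops_at_unique)

lemma cost_eq_nn_integral:
  assumes "stops_at b T n"
  shows "cost b T = (\<integral>\<^sup>+ m. ennreal (b m) \<partial>count_space {..n})"
proof -
  have "{m. \<forall>l<m. b l < T} = {..n}"
    using assms unfolding stops_at_def by (auto 0 3 dest: leD intro: ccontr)
  then show ?thesis
    using assms unfolding cost_def stops_at_def by auto
qed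

lemma cost_eq_suminf:
  assumes "stops_at b T n"
  shows "cost b T = (\<Sum>k. ennreal (b (n - int k)))"
proof -
  have "bij_betw (\<lambda>k. n - int k) UNIV {..n}"
    by (rule bij_betwI[where g = "\<lambda>m. nat (n - m)"]) auto
  from nn_integral_bij_count_space[OF this, of "\<lambda>m. ennreal (b m)"] show ?thesis
    by (simp add: cost_eq_nn_integral[OF assms] flip: nn_integral_count_space_nat)
qed

lemma stops_at_if_cost_finite: "cost b T < \<infinity> \<Longrightarrow> \<exists>n. stops_at b T n"
  unfolding cost_def stops_at_def by (auto split: if_splits)

lemma ex_stops_at:
  assumes "mono b" "b m < T" "T \<le> b n"
  shows "\<exists>n. stops_at b T n"
proof -
  have "m < n"
    using assms monoD[of b n m] by (cases "n \<le> m") auto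
  then obtain j where "n = m + int j"
    using zle_iff_zadd by (meson less_imp_le)
  then obtain k where reached: "T \<le> b (m + int k)" "\<And>i. i < k \<Longrightarrow> b (m + int i) < T"
    using ex_least_nat_le[of "\<lambda>k. T \<le> b (m + int k)" j] \<open>T \<le> b n\<close> by (auto simp: not_le)
  have "b l < T" if "l < m + int k" for l
  proof (cases "l \<le> m")
    case True
    then show ?thesis using assms monoD[of b l m] by simp
  next
    case False
    then show ?thesis using that reached(2)[of "nat (l - m)"] by simp
  qed
  then show ?thesis
    using reached(1) unfolding stops_at_def by blast
qed

lemma measurable_bid [measurable]: "(\<lambda>b. b n) \<in> borel_measurable (Pi\<^sub>M UNIV (\<lambda>_. borel))"
  by (rule measurable_component_singleton) simp

lemma measurable_strategy [measurable]: "Measurable.pred (Pi\<^sub>M UNIV (\<lambda>_. borel)) strategy"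
  unfolding strategy_def strict_mono_def by measurable

lemma measurable_stops_at [measurable]:
  "Measurable.pred (Pi\<^sub>M UNIV (\<lambda>_. borel)) (\<lambda>b. stops_at b T n)"
  unfolding stops_at_def by measurable

lemma measurable_first_bid [measurable]:
  "(\<lambda>b. first_bid b T) \<in> Pi\<^sub>M UNIV (\<lambda>_. borel) \<rightarrow>\<^sub>M count_space UNIV"
  unfolding first_bid_def
  by (rule measurable_THE[where I = UNIV]) (auto intro: stops_at_unique)

lemma measurable_sum_below [measurable]:
  "(\<lambda>b. sum_below b m) \<in> borel_measurable (Pi\<^sub>M UNIV (\<lambda>_. borel))"
  unfolding sum_below_def by measurable

lemma measurable_bid_count [measurable]:
  "(\<lambda>b. bid_count b n) \<in> borel_measurable (Pi\<^sub>M UNIV (\<lambda>_. borel))"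
  unfolding bid_count_def
  by (rule measurable_compose[OF measurable_first_bid, where g = "\<lambda>i. real_of_int (n - i)"]) simp

lemma measurable_cost [measurable]:
  "(\<lambda>b. cost b T) \<in> borel_measurable (Pi\<^sub>M UNIV (\<lambda>_. borel))"
proof -
  have "cost b T
      = (if \<exists>n. stops_at b T n then \<Sum>k. ennreal (b (first_bid b T - int k)) else \<infinity>)" for b
    by (auto simp: cost_eq_suminf first_bid_eq) (auto simp: cost_def stops_at_def)
  moreover have "(\<lambda>b. b (first_bid b T - int k)) \<in> borel_measurable (Pi\<^sub>M UNIV (\<lambda>_. borel))" for k
    by (rule measurable_compose_countable[where f = "\<lambda>n b. b (n - int k)"]) measurable
  ultimately show ?thesis by simp
qed

lemma summable_shift_int:
  fixes b :: "int \<Rightarrow> real"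
  assumes "summable (\<lambda>k. b (m - int k))"
  shows "summable (\<lambda>k. b (n - int k))"
proof (cases "n \<le> m")
  case True
  have "summable (\<lambda>k. b (m - int (k + nat (m - n))))"
    using assms by (subst summable_iff_shift)
  then show ?thesis using True by (simp add: algebra_simps)
next
  case False
  have "summable (\<lambda>k. b (n - int (k + nat (n - m))))"
    using assms False by (simp add: algebra_simps)
  then show ?thesis by (subst (asm) summable_iff_shift)
qed

locale finite_cost_strategy =
  fixes b :: "int \<Rightarrow> real"
  assumes strategy: "strategy b"
    and unbounded: "\<exists>n. T \<le> b n"
    and summable: "summable (\<lambda>k. b (- int k))"
begin

lemma pos: "0 < b n"
  using strategy by (simp add: strategy_def)

lemma summable_bids: "summable (\<lambda>k. b (m - int k))"
  using summable summable_shift_int[of b 0 m] by simp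

lemma stops_at_first_bid:
  assumes "0 < T"
  shows "stops_at b T (first_bid b T)"
proof -
  have "(\<lambda>k. b (0 - int k)) \<longlonglongrightarrow> 0"
    using summable_bids by (rule summable_LIMSEQ_zero)
  then have "\<forall>\<^sub>F k in sequentially. b (0 - int k) < T"
    using assms by (rule order_tendstoD)
  then obtain m where "b m < T"
    using eventually_happens by fastforce
  moreover obtain n where "T \<le> b n"
    using unbounded by blast
  ultimately obtain l where "stops_at b T l"
    using ex_stops_at[of b m T n] strategy by (auto simp: strategy_def strict_mono_mono)
  then show ?thesis by (simp add: first_bid_eq)
qed

lemma bid_less_iff:
  assumes "0 < T"
  shows "b n < T \<longleftrightarrow> n < first_bid b T"
proof
  assume "b n < T"
  then have "b n < b (first_bid b T)"
    using stops_at_first_bid[OF assms] by (simp add: stops_at_def)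
  then show "n < first_bid b T"
    using strategy by (simp add: strategy_def strict_mono_less)
qed (use stops_at_first_bid[OF assms] in \<open>simp add: stops_at_def\<close>)

lemma sum_below_pos: "0 < sum_below b m"
  unfolding sum_below_def using summable_bids pos by (intro suminf_pos) auto

lemma sum_below_step: "sum_below b (m + 1) = sum_below b m + b m"
proof -
  have "(\<Sum>k. b (m - int (Suc k))) = (\<Sum>k. b (m - int k)) - b (m - int 0)"
    by (rule suminf_split_head[OF summable_bids])
  then show ?thesis by (simp add: sum_below_def algebra_simps)
qed

lemma cost_eq_sum_below: "0 < T \<Longrightarrow> cost b T = ennreal (sum_below b (first_bid b T + 1))"
  by (auto simp: cost_eq_suminf[OF stops_at_first_bid] sum_below_def
      intro!: suminf_ennreal2 summable_bids less_imp_le pos)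

text \<open>The sum of bids is a convex function of their number, with subgradient \<open>\<theta>\<close> where the bids
  cross \<open>\<theta>\<close>.\<close>
lemma sum_below_ge:
  assumes "0 < \<theta>"
  shows "sum_below b (first_bid b \<theta>) + \<theta> * (bid_count b m - bid_count b (first_bid b \<theta>))
    \<le> sum_below b m"
proof (induction m rule: int_induct[where k = "first_bid b \<theta>"])
  case (step1 m)
  then have "\<theta> \<le> b m"
    using bid_less_iff[OF assms, of m] by simp
  then show ?case
    using step1 sum_below_step[of m] by (simp add: bid_count_def algebra_simps)
next
  case (step2 m)
  then have "b (m - 1) < \<theta>"
    using bid_less_iff[OF assms, of "m - 1"] by simp
  then show ?case
    using step2 sum_below_step[of "m - 1"] by (simp add: bid_count_def algebra_simps)
qed simp

lemma abs_bid_count_le: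
  assumes "0 < T"
  shows "\<bar>bid_count b (first_bid b T)\<bar>
    \<le> sum_below b (first_bid b T) + sum_below b (first_bid b 1) / T"
proof -
  have "bid_count b (first_bid b T) \<le> sum_below b (first_bid b T)"
    using sum_below_ge[of 1 "first_bid b T"] sum_below_pos[of "first_bid b 1"]
    by (simp add: bid_count_def)
  moreover have "T * (- bid_count b (first_bid b T)) \<le> sum_below b (first_bid b 1)"
    using sum_below_ge[OF assms, of "first_bid b 1"] sum_below_pos[of "first_bid b T"]
    by (simp add: bid_count_def)
  then have "- bid_count b (first_bid b T) \<le> sum_below b (first_bid b 1) / T"
    using assms by (simp add: field_simps)
  moreover have "0 < sum_below b (first_bid b T)" "0 < sum_below b (first_bid b 1) / T"
    using assms sum_below_pos by simp_all
  ultimately show ?thesis by linarith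
qed

end

lemma finite_cost_strategyI:
  assumes "strategy b" and finite: "\<And>j::nat. cost b (real (Suc j)) < \<infinity>"
  shows "finite_cost_strategy b"
proof
  fix T :: real
  obtain j :: nat where "T \<le> real j"
    using real_arch_simple by blast
  moreover obtain n where "real (Suc j) \<le> b n"
    using stops_at_if_cost_finite[OF finite] by (auto simp: stops_at_def)
  ultimately show "\<exists>n. T \<le> b n"
    by (intro exI[of _ n]) simp
next
  obtain n where "stops_at b (real (Suc 0)) n"
    using stops_at_if_cost_finite[OF finite] by blast
  then have "(\<Sum>k. ennreal (b (n - int k))) \<noteq> \<infinity>"
    using finite[of 0] by (simp add: cost_eq_suminf)
  then have "summable (\<lambda>k. b (n - int k))"
    using \<open>strategy b\<close> by (intro summable_suminf_not_top) (auto simp: strategy_def less_imp_le)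
  then show "summable (\<lambda>k. b (- int k))"
    using summable_shift_int[of b n 0] by simp
qed (rule assms)

section \<open>The lower bound\<close>

locale robust_strategy =
  fixes M :: "(int \<Rightarrow> real) measure" and \<rho> :: real
  assumes randomized: "randomized_strategy M" and robust: "robust M \<rho>"
begin

sublocale prob_space M
  using randomized by (simp add: randomized_strategy_def)

lemma sets_M [measurable_cong]: "sets M = sets (Pi\<^sub>M UNIV (\<lambda>_. borel))"
  using randomized by (simp add: randomized_strategy_def)

lemma exp_cost_finite: "0 < T \<Longrightarrow> exp_cost M T < \<infinity>"
  using robust unfolding robust_def
  by (metis ennreal_less_top infinity_ennreal_def order.strict_trans1)

lemma AE_finite_cost_strategy: "AE b in M. finite_cost_strategy b"
proof -
  have "AE b in M. cost b (real (Suc j)) \<noteq> \<infinity>" for j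
    using exp_cost_finite[of "real (Suc j)"]
    by (intro nn_integral_noteq_infinite) (auto simp: exp_cost_def)
  then have "AE b in M. \<forall>j::nat. cost b (real (Suc j)) \<noteq> \<infinity>"
    by (simp add: AE_all_countable)
  moreover have "AE b in M. strategy b"
    using randomized by (simp add: randomized_strategy_def)
  ultimately show ?thesis
    by eventually_elim (auto intro!: finite_cost_strategyI simp: top.not_eq_extremum)
qed

definition mean_count :: "((int \<Rightarrow> real) \<Rightarrow> int) \<Rightarrow> real" where
  "mean_count N = expectation (\<lambda>b. bid_count b (N b))"

definition mean_sum :: "((int \<Rightarrow> real) \<Rightarrow> int) \<Rightarrow> real" where
  "mean_sum N = expectation (\<lambda>b. sum_below b (N b))"

definition integrable_stop :: "((int \<Rightarrow> real) \<Rightarrow> int) \<Rightarrow> bool" where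
  "integrable_stop N \<longleftrightarrow> integrable M (\<lambda>b. bid_count b (N b)) \<and> integrable M (\<lambda>b. sum_below b (N b))"

abbreviation reaching :: "real \<Rightarrow> (int \<Rightarrow> real) \<Rightarrow> int" where
  "reaching T \<equiv> \<lambda>b. first_bid b T"

abbreviation beyond :: "real \<Rightarrow> (int \<Rightarrow> real) \<Rightarrow> int" where
  "beyond T \<equiv> \<lambda>b. first_bid b T + 1"

lemma measurable_at_first_bid:
  fixes f :: "int \<Rightarrow> (int \<Rightarrow> real) \<Rightarrow> real"
  assumes "\<And>n. f n \<in> borel_measurable (Pi\<^sub>M UNIV (\<lambda>_. borel))"
  shows "(\<lambda>b. f (first_bid b T) b) \<in> borel_measurable M"
  unfolding measurable_cong_sets[OF sets_M refl]
  by (rule measurable_compose_countable[OF assms measurable_first_bid])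

lemma measurable_sum_below_reaching: "(\<lambda>b. sum_below b (reaching T b)) \<in> borel_measurable M"
  by (rule measurable_at_first_bid[OF measurable_sum_below])

lemma measurable_sum_below_beyond: "(\<lambda>b. sum_below b (beyond T b)) \<in> borel_measurable M"
  by (rule measurable_at_first_bid[where f = "\<lambda>n b. sum_below b (n + 1)"])
    (rule measurable_sum_below)

lemma exp_cost_eq_nn_integral:
  assumes "0 < T"
  shows "exp_cost M T = (\<integral>\<^sup>+ b. ennreal (sum_below b (beyond T b)) \<partial>M)"
  unfolding exp_cost_def
proof (rule nn_integral_cong_AE)
  show "AE b in M. cost b T = ennreal (sum_below b (beyond T b))"
    using AE_finite_cost_strategy
    by eventually_elim (rule finite_cost_strategy.cost_eq_sum_below[OF _ assms])
qed

lemma AE_sum_below_pos: "AE b in M. 0 < sum_below b (N b)"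
  using AE_finite_cost_strategy by eventually_elim (rule finite_cost_strategy.sum_below_pos)

lemma AE_sum_below_nonneg: "AE b in M. 0 \<le> sum_below b (N b)"
  using AE_sum_below_pos[of N] by eventually_elim simp

lemma integrable_sum_below_beyond:
  assumes "0 < T"
  shows "integrable M (\<lambda>b. sum_below b (beyond T b))"
  using exp_cost_finite[OF assms]
  by (intro integrableI_nonneg measurable_sum_below_beyond AE_sum_below_nonneg)
    (simp add: exp_cost_eq_nn_integral[OF assms])

lemma integrable_sum_below_reaching:
  assumes "0 < T"
  shows "integrable M (\<lambda>b. sum_below b (reaching T b))"
proof (rule Bochner_Integration.integrable_bound[OF integrable_sum_below_beyond[OF assms]])
  show "AE b in M. norm (sum_below b (reaching T b)) \<le> norm (sum_below b (beyond T b))"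
    using AE_finite_cost_strategy
  proof eventually_elim
    case (elim b)
    then interpret finite_cost_strategy b .
    show ?case
      using sum_below_pos[of "reaching T b"] pos[of "reaching T b"] by (simp add: sum_below_step)
  qed
qed (rule measurable_sum_below_reaching)

lemma integrable_bid_count_reaching:
  assumes "0 < T"
  shows "integrable M (\<lambda>b. bid_count b (reaching T b))"
proof (rule Bochner_Integration.integrable_bound)
  show "integrable M (\<lambda>b. sum_below b (reaching T b) + sum_below b (reaching 1 b) / T)"
    using assms by (intro Bochner_Integration.integrable_add integrable_divide
        integrable_sum_below_reaching) auto
  show "AE b in M. norm (bid_count b (reaching T b))
      \<le> norm (sum_below b (reaching T b) + sum_below b (reaching 1 b) / T)"
    using AE_finite_cost_strategy
  proof eventually_elim
    case (elim b)
    then show ?case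
      using finite_cost_strategy.abs_bid_count_le[OF elim assms] by simp
  qed
  show "(\<lambda>b. bid_count b (reaching T b)) \<in> borel_measurable M"
    by (rule measurable_at_first_bid[OF measurable_bid_count])
qed

lemma integrable_stop_reaching: "0 < T \<Longrightarrow> integrable_stop (reaching T)"
  by (simp add: integrable_stop_def integrable_sum_below_reaching integrable_bid_count_reaching)

lemma integrable_stop_beyond: "0 < T \<Longrightarrow> integrable_stop (beyond T)"
  by (simp add: integrable_stop_def bid_count_Suc integrable_sum_below_beyond
      integrable_bid_count_reaching)

lemma mean_count_beyond: "0 < T \<Longrightarrow> mean_count (beyond T) = mean_count (reaching T) + 1"
  by (simp add: mean_count_def bid_count_Suc integrable_bid_count_reaching prob_space)

lemma mean_count_reaching_one: "mean_count (reaching 1) = 0"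
  by (simp add: mean_count_def bid_count_def)

lemma mean_sum_reaching_pos: "0 < T \<Longrightarrow> 0 < mean_sum (reaching T)"
  unfolding mean_sum_def
  by (intro expectation_greater integrable_sum_below_reaching AE_sum_below_pos)

lemma mean_sum_beyond_pos: "0 < T \<Longrightarrow> 0 < mean_sum (beyond T)"
  unfolding mean_sum_def
  by (intro expectation_greater integrable_sum_below_beyond AE_sum_below_pos)

lemma exp_cost_eq_mean_sum: "0 < T \<Longrightarrow> exp_cost M T = ennreal (mean_sum (beyond T))"
  unfolding exp_cost_eq_nn_integral mean_sum_def
  by (intro nn_integral_eq_integral integrable_sum_below_beyond AE_sum_below_nonneg)

lemma mean_sum_beyond_le_if_exp_cost_le:
  assumes "0 < T" "exp_cost M T \<le> ennreal c"
  shows "mean_sum (beyond T) \<le> c"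
  using assms mean_sum_beyond_pos[of T]
  by (cases "0 \<le> c") (auto simp: exp_cost_eq_mean_sum ennreal_neg)

lemma mean_sum_beyond_le: "0 < T \<Longrightarrow> mean_sum (beyond T) \<le> \<rho> * T"
  using robust by (intro mean_sum_beyond_le_if_exp_cost_le) (auto simp: robust_def)

lemma robustness_pos: "0 < \<rho>"
  using mean_sum_beyond_le[of 1] mean_sum_beyond_pos[of 1] by simp

definition support_line :: "real \<Rightarrow> real \<Rightarrow> real" where
  "support_line \<theta> t = mean_sum (reaching \<theta>) + \<theta> * (t - mean_count (reaching \<theta>))"

lemma support_line_le_mean_sum:
  assumes "0 < \<theta>" and stop: "integrable_stop N"
  shows "support_line \<theta> (mean_count N) \<le> mean_sum N"
proof -
  let ?line = "\<lambda>b. sum_below b (reaching \<theta> b)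
      + \<theta> * (bid_count b (N b) - bid_count b (reaching \<theta> b))"
  have "support_line \<theta> (mean_count N) = expectation ?line"
    using stop assms(1) integrable_sum_below_reaching integrable_bid_count_reaching
    by (simp add: support_line_def mean_count_def mean_sum_def integrable_stop_def)
  also have "\<dots> \<le> mean_sum N"
    unfolding mean_sum_def
  proof (rule integral_mono_AE)
    show "AE b in M. ?line b \<le> sum_below b (N b)"
      using AE_finite_cost_strategy
      by eventually_elim (rule finite_cost_strategy.sum_below_ge[OF _ \<open>0 < \<theta>\<close>])
  qed (use stop assms(1) integrable_sum_below_reaching integrable_bid_count_reaching
      in \<open>auto simp: integrable_stop_def\<close>)
  finally show ?thesis .
qed

lemma mean_count_reaching_gap:
  assumes "0 < T" "0 < R"
  shows "mean_count (reaching T) + 1 - \<rho> * T / R \<le> mean_count (reaching R)"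
proof -
  have "support_line R (mean_count (beyond T)) \<le> \<rho> * T"
    using support_line_le_mean_sum[OF \<open>0 < R\<close> integrable_stop_beyond[OF \<open>0 < T\<close>]]
      mean_sum_beyond_le[OF \<open>0 < T\<close>] by simp
  then have "R * (mean_count (reaching T) + 1 - mean_count (reaching R)) \<le> \<rho> * T"
    using mean_sum_reaching_pos[OF \<open>0 < R\<close>] \<open>0 < T\<close>
    by (simp add: support_line_def mean_count_beyond)
  then show ?thesis using \<open>0 < R\<close> by (simp add: field_simps)
qed

lemma mean_count_reaching_unbounded:
  shows "\<exists>T>0. x \<le> mean_count (reaching T)" and "\<exists>T>0. mean_count (reaching T) \<le> x"
proof -
  let ?q = "2 * \<rho>"
  have count_step: "mean_count (reaching T) + 1 / 2 \<le> mean_count (reaching (?q * T))" if "0 < T" for T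
    using mean_count_reaching_gap[of T "?q * T"] that robustness_pos by simp
  have count_ge: "real n / 2 \<le> mean_count (reaching (?q ^ n))" for n
  proof (induction n)
    case (Suc n)
    then show ?case using count_step[of "?q ^ n"] robustness_pos by (simp add: field_simps)
  qed (simp add: mean_count_reaching_one)
  have count_le: "mean_count (reaching (1 / ?q ^ n)) \<le> - (real n / 2)" for n
  proof (induction n)
    case (Suc n)
    then show ?case using count_step[of "1 / ?q ^ Suc n"] robustness_pos by (simp add: field_simps)
  qed (simp add: mean_count_reaching_one)
  obtain n :: nat where n_ge: "2 * \<bar>x\<bar> \<le> real n"
    using real_arch_simple by blast
  show "\<exists>T>0. x \<le> mean_count (reaching T)"
    using count_ge[of n] n_ge robustness_pos by (intro exI[of _ "?q ^ n"]) auto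
  show "\<exists>T>0. mean_count (reaching T) \<le> x"
    using count_le[of n] n_ge robustness_pos by (intro exI[of _ "1 / ?q ^ n"]) auto
qed

text \<open>The least mean sum of bids over all random numbers of bids of mean t, as the supremum of the
  lines supporting it.\<close>
definition least_sum :: "real \<Rightarrow> real" where
  "least_sum t = (SUP \<theta>\<in>{0<..}. support_line \<theta> t)"

lemma support_line_mono: "0 < \<theta> \<Longrightarrow> t \<le> t' \<Longrightarrow> support_line \<theta> t \<le> support_line \<theta> t'"
  by (simp add: support_line_def)

lemma bdd_above_support_lines: "bdd_above ((\<lambda>\<theta>. support_line \<theta> t) ` {0<..})"
proof -
  obtain T where T_reaches: "0 < T" "t \<le> mean_count (reaching T)"
    using mean_count_reaching_unbounded(1) by blast
  have "support_line \<theta> t \<le> mean_sum (reaching T)" if "0 < \<theta>" for \<theta>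
    using support_line_mono[OF that T_reaches(2)]
      support_line_le_mean_sum[OF that integrable_stop_reaching[OF T_reaches(1)]] by linarith
  then show ?thesis by (auto simp: bdd_above_def)
qed

lemma support_line_le_least_sum: "0 < \<theta> \<Longrightarrow> support_line \<theta> t \<le> least_sum t"
  unfolding least_sum_def by (intro cSUP_upper bdd_above_support_lines) simp

lemma least_sum_leI: "(\<And>\<theta>. 0 < \<theta> \<Longrightarrow> support_line \<theta> t \<le> c) \<Longrightarrow> least_sum t \<le> c"
  unfolding least_sum_def by (intro cSUP_least) auto

lemma least_sum_le_mean_sum: "integrable_stop N \<Longrightarrow> least_sum (mean_count N) \<le> mean_sum N"
  by (intro least_sum_leI support_line_le_mean_sum)

lemma mono_least_sum: "mono least_sum"
  by (intro monoI least_sum_leI order.trans[OF support_line_mono support_line_le_least_sum])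

lemma least_sum_pos: "0 < least_sum t"
proof -
  obtain T where T_reaches: "0 < T" "mean_count (reaching T) \<le> t"
    using mean_count_reaching_unbounded(2) by blast
  then have "mean_sum (reaching T) \<le> support_line T t"
    by (simp add: support_line_def)
  then show ?thesis
    using mean_sum_reaching_pos[OF T_reaches(1)] support_line_le_least_sum[OF T_reaches(1), of t]
    by linarith
qed

lemma convex_least_sum: "convex_on UNIV least_sum"
proof (rule convex_onI)
  fix u x y :: real assume u_bounds: "0 < u" "u < 1"
  show "least_sum ((1 - u) *\<^sub>R x + u *\<^sub>R y) \<le> (1 - u) * least_sum x + u * least_sum y"
  proof (rule least_sum_leI)
    fix \<theta> :: real assume "0 < \<theta>"
    have "support_line \<theta> ((1 - u) *\<^sub>R x + u *\<^sub>R y)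
        = (1 - u) * support_line \<theta> x + u * support_line \<theta> y"
      by (simp add: support_line_def algebra_simps)
    also have "\<dots> \<le> (1 - u) * least_sum x + u * least_sum y"
      using u_bounds \<open>0 < \<theta>\<close> by (intro add_mono mult_left_mono support_line_le_least_sum) auto
    finally show "support_line \<theta> ((1 - u) *\<^sub>R x + u *\<^sub>R y)
        \<le> (1 - u) * least_sum x + u * least_sum y" .
  qed
qed simp

lemma least_sum_increment_ge:
  assumes "0 < \<theta>" "mean_count (reaching \<theta>) \<le> t" "t \<le> t'"
  shows "\<theta> * (t' - t) \<le> least_sum t' - least_sum t"
proof -
  have "least_sum t \<le> least_sum t' - \<theta> * (t' - t)"
  proof (rule least_sum_leI)
    fix \<eta> :: real assume "0 < \<eta>"
    show "support_line \<eta> t \<le> least_sum t' - \<theta> * (t' - t)"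
    proof (cases "\<theta> \<le> \<eta>")
      case True
      then have "\<theta> * (t' - t) \<le> \<eta> * (t' - t)"
        using \<open>t \<le> t'\<close> by (intro mult_right_mono) auto
      moreover have "support_line \<eta> t = support_line \<eta> t' - \<eta> * (t' - t)"
        by (simp add: support_line_def algebra_simps)
      ultimately show ?thesis
        using support_line_le_least_sum[OF \<open>0 < \<eta>\<close>, of t'] by linarith
    next
      case False
      have "support_line \<eta> t
          = support_line \<eta> (mean_count (reaching \<theta>)) + \<eta> * (t - mean_count (reaching \<theta>))"
        by (simp add: support_line_def algebra_simps)
      also have "\<dots> \<le> mean_sum (reaching \<theta>) + \<theta> * (t - mean_count (reaching \<theta>))"
        using False assms(2) \<open>0 < \<theta>\<close> \<open>0 < \<eta>\<close>
        by (intro add_mono mult_right_mono support_line_le_mean_sum integrable_stop_reaching) auto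
      also have "\<dots> = support_line \<theta> t' - \<theta> * (t' - t)"
        by (simp add: support_line_def algebra_simps)
      also have "\<dots> \<le> least_sum t' - \<theta> * (t' - t)"
        using support_line_le_least_sum[OF \<open>0 < \<theta>\<close>] by simp
      finally show ?thesis .
    qed
  qed
  then show ?thesis by simp
qed

lemma least_sum_succ_le:
  assumes "0 < \<theta>" "t \<le> mean_count (reaching \<theta>)"
  shows "least_sum (t + 1) \<le> \<rho> * \<theta>"
proof -
  have "least_sum (t + 1) \<le> least_sum (mean_count (beyond \<theta>))"
    using assms by (intro monoD[OF mono_least_sum]) (simp add: mean_count_beyond)
  also have "\<dots> \<le> mean_sum (beyond \<theta>)"
    using assms by (intro least_sum_le_mean_sum integrable_stop_beyond)
  also have "\<dots> \<le> \<rho> * \<theta>"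
    using assms by (intro mean_sum_beyond_le)
  finally show ?thesis .
qed

lemma least_sum_advanced_growth:
  assumes "t \<le> t'"
  shows "(t' - t) * (1 / \<rho> * least_sum (t + 1)) \<le> least_sum t' - least_sum t"
proof (cases "t = t'")
  case False
  have "1 / \<rho> * least_sum (t + 1) \<le> (least_sum t' - least_sum t) / (t' - t)"
  proof (rule dense_le_bounded)
    show "0 < 1 / \<rho> * least_sum (t + 1)"
      using least_sum_pos robustness_pos by simp
    fix \<theta> assume theta_bounds: "0 < \<theta>" "\<theta> < 1 / \<rho> * least_sum (t + 1)"
    then have "\<not> least_sum (t + 1) \<le> \<rho> * \<theta>"
      using robustness_pos by (simp add: field_simps)
    then have "mean_count (reaching \<theta>) \<le> t"
      using least_sum_succ_le[OF theta_bounds(1), of t] by linarith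
    then have "\<theta> * (t' - t) \<le> least_sum t' - least_sum t"
      using theta_bounds(1) assms by (intro least_sum_increment_ge)
    then show "\<theta> \<le> (least_sum t' - least_sum t) / (t' - t)"
      using False assms by (simp add: field_simps)
  qed
  then show ?thesis using False assms by (simp add: field_simps)
qed simp

lemma mean_sum_beyond_one_gt:
  assumes s_bounds: "0 < s" "s \<le> 1" and "\<rho> < rho s" and p_bounds: "0 \<le> p" "p \<le> 1"
  shows "rho s * (1 - exp (- s * p)) < mean_sum (beyond 1) * (1 - s * (1 - p))"
proof -
  interpret advanced_growth least_sum s "1 / \<rho>"
  proof
    show "s * exp (- s) < 1 / \<rho>"
      using assms robustness_pos by (simp add: rho_def exp_minus field_simps)
    show "continuous_on UNIV least_sum"
      using convex_least_sum by (rule convex_on_continuous[rotated]) simp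
  qed (use s_bounds least_sum_pos least_sum_advanced_growth in auto)
  have "rho s * (1 - exp (- s * p)) < least_sum 1 * (1 - s * (1 - p))"
    unfolding rho_def
  proof (rule value_at_one_gt[OF _ p_bounds])
    fix t t' :: real assume "0 \<le> t" "t \<le> t'"
    then show "t' - t \<le> least_sum t' - least_sum t"
      using least_sum_increment_ge[of 1 t t'] by (simp add: mean_count_reaching_one)
  qed
  also have "\<dots> \<le> mean_sum (beyond 1) * (1 - s * (1 - p))"
  proof (rule mult_right_mono)
    show "least_sum 1 \<le> mean_sum (beyond 1)"
      using least_sum_le_mean_sum[OF integrable_stop_beyond[of 1]]
      by (simp add: mean_count_beyond mean_count_reaching_one)
    show "0 \<le> 1 - s * (1 - p)"
      using s_bounds p_bounds mult_mono[of s 1 "1 - p" 1] by simp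
  qed
  finally show ?thesis .
qed

end

section \<open>Randomized strategies from bidding curves\<close>

lemma UN_atLeastAtMost_eq_lessThan:
  fixes c :: real
  shows "(\<Union>n. {c - real (Suc n)..c - 1 / real (Suc n)}) = {..<c}"
proof (intro set_eqI iffI)
  fix x assume "x \<in> (\<Union>n. {c - real (Suc n)..c - 1 / real (Suc n)})"
  then obtain n where "x \<le> c - 1 / real (Suc n)"
    by auto
  moreover have "0 < 1 / real (Suc n)"
    by simp
  ultimately show "x \<in> {..<c}"
    unfolding lessThan_iff by linarith
next
  fix x assume "x \<in> {..<c}"
  then obtain m where "1 / real (Suc m) < c - x"
    using reals_Archimedean[of "c - x"] by (auto simp: inverse_eq_divide)
  moreover obtain n :: nat where "c - x \<le> real n"
    using real_arch_simple by blast
  moreover have "1 / real (Suc (max m n)) \<le> 1 / real (Suc m)"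
    by (intro divide_left_mono) auto
  ultimately have "x \<in> {c - real (Suc (max m n))..c - 1 / real (Suc (max m n))}"
    by simp
  then show "x \<in> (\<Union>n. {c - real (Suc n)..c - 1 / real (Suc n)})" by blast
qed

lemma set_nn_integral_atMost_le:
  fixes f :: "real \<Rightarrow> real"
  assumes [measurable]: "f \<in> borel_measurable borel" and nonneg: "\<And>x. 0 \<le> f x"
    and integrable: "\<And>a b. f integrable_on {a..b}"
    and integral_le: "\<And>a b. b < c \<Longrightarrow> integral {a..b} f \<le> C"
  shows "(\<integral>\<^sup>+x\<in>{..c}. ennreal (f x) \<partial>lborel) \<le> ennreal C"
proof -
  define \<nu> where "\<nu> = density lborel (\<lambda>x. ennreal (f x))"
  define I where "I n = {c - real (Suc n)..c - 1 / real (Suc n)}" for n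
  have [simp]: "sets \<nu> = sets borel"
    by (simp add: \<nu>_def)
  have "incseq I"
  proof (rule incseq_SucI)
    fix n show "I n \<subseteq> I (Suc n)"
      unfolding I_def
      by (intro iffD2[OF atLeastatMost_subset_iff] disjI2 conjI diff_left_mono divide_left_mono) auto
  qed
  have "(\<Union>n. I n) = {..<c}"
    unfolding I_def by (rule UN_atLeastAtMost_eq_lessThan)
  moreover have "emeasure \<nu> (I n) \<le> ennreal C" for n
  proof -
    have "(\<integral>\<^sup>+x\<in>I n. ennreal (f x) \<partial>lborel) = ennreal (integral (I n) f)"
      unfolding I_def
      by (intro nn_integral_has_integral_lebesgue' nonneg integrable_integral integrable)
    also have "\<dots> \<le> ennreal C"
      unfolding I_def by (intro ennreal_leI integral_le) simp
    finally show ?thesis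
      by (simp add: \<nu>_def emeasure_density I_def)
  qed
  ultimately have "emeasure \<nu> {..<c} \<le> ennreal C"
    using SUP_emeasure_incseq[of I \<nu>] \<open>incseq I\<close>
    by (metis SUP_least I_def \<open>sets \<nu> = sets borel\<close> atLeastAtMost_borel image_subsetI)
  moreover have "emeasure \<nu> {..<c} = (\<integral>\<^sup>+x\<in>{..c}. ennreal (f x) \<partial>lborel)"
    unfolding \<nu>_def using AE_lborel_singleton[of c]
    by (simp add: emeasure_density)
      (intro nn_integral_cong_AE, auto elim!: eventually_mono simp: indicator_def)
  ultimately show ?thesis by simp
qed

lemma nn_integral_lborel_eq_unit_shifts:
  fixes f :: "real \<Rightarrow> ennreal"
  assumes [measurable]: "f \<in> borel_measurable borel"
  shows "(\<integral>\<^sup>+x. f x \<partial>lborel) = (\<integral>\<^sup>+u\<in>{0<..<1}. (\<integral>\<^sup>+n. f (of_int n + u) \<partial>count_space UNIV) \<partial>lborel)"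
proof -
  have cell: "(\<integral>\<^sup>+u\<in>{0<..<1}. f (of_int n + u) \<partial>lborel)
      = (\<integral>\<^sup>+x\<in>{of_int n<..<of_int n + 1}. f x \<partial>lborel)" for n
    by (subst nn_integral_real_affine[where c = 1 and t = "of_int n"])
      (auto intro!: nn_integral_cong split: split_indicator)
  have partition: "(\<integral>\<^sup>+n. f x * indicator {of_int n<..<of_int n + 1} x \<partial>count_space UNIV) = f x"
    if "x \<notin> \<int>" for x
  proof -
    have "x \<in> {of_int n<..<of_int n + 1} \<longleftrightarrow> n \<in> {\<lfloor>x\<rfloor>}" for n
      using that floor_eq_iff[of x n] by (auto simp: less_le)
    then have "f x * indicator {of_int n<..<of_int n + 1} x = f x * indicator {\<lfloor>x\<rfloor>} n" for n
      by (simp only: indicator_def)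
    then show ?thesis
      by (simp add: nn_integral_cmult_indicator)
  qed
  have "AE x in lborel. (x::real) \<notin> \<int>"
    by (intro AE_not_in countable_imp_null_set_lborel countable_int)
  then have "(\<integral>\<^sup>+x. f x \<partial>lborel)
      = (\<integral>\<^sup>+x. \<integral>\<^sup>+n. f x * indicator {of_int n<..<of_int n + 1} x \<partial>count_space UNIV \<partial>lborel)"
    by (intro nn_integral_cong_AE) (auto elim!: eventually_mono simp: partition)
  also have "\<dots> = (\<integral>\<^sup>+n. \<integral>\<^sup>+x. f x * indicator {of_int n<..<of_int n + 1} x
      \<partial>lborel \<partial>count_space UNIV)"
    by (rule nn_integral_count_space_nn_integral) simp_all
  also have "\<dots> = (\<integral>\<^sup>+n. (\<integral>\<^sup>+u\<in>{0<..<1}. f (of_int n + u) \<partial>lborel) \<partial>count_space UNIV)"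
    by (simp add: cell)
  also have "\<dots> = (\<integral>\<^sup>+u. \<integral>\<^sup>+n. f (of_int n + u) * indicator {0<..<1} u \<partial>count_space UNIV \<partial>lborel)"
    by (rule nn_integral_count_space_nn_integral[symmetric]) simp_all
  finally show ?thesis
    by (simp add: nn_integral_multc)
qed

locale bidding_curve =
  fixes \<beta> :: "real \<Rightarrow> real"
  assumes pos: "0 < \<beta> x"
    and mono: "mono \<beta>"
    and less_succ: "x \<notin> \<int> \<Longrightarrow> \<beta> x < \<beta> (x + 1)"
    and ex_less: "0 < T \<Longrightarrow> \<exists>x. \<beta> x < T"
    and ex_ge: "\<exists>x. T \<le> \<beta> x"
begin

definition bids :: "real \<Rightarrow> int \<Rightarrow> real" where
  "bids u n = \<beta> (of_int n + u)"

definition mixture :: "(int \<Rightarrow> real) measure" where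
  "mixture = distr (uniform_measure lborel {0<..<1}) (Pi\<^sub>M UNIV (\<lambda>_. borel)) bids"

lemma borel_measurable_curve [measurable]: "\<beta> \<in> borel_measurable borel"
  using mono by (rule borel_measurable_mono)

lemma integrable_curve: "\<beta> integrable_on {a..b}"
  using mono by (intro integrable_on_mono_on) (simp add: mono_on_def monoD)

lemma strategy_bids:
  assumes "0 < u" "u < 1"
  shows "strategy (bids u)"
proof -
  have "strict_mono (bids u)"
  proof (rule strict_monoI)
    fix m n :: int assume "m < n"
    have "\<lfloor>of_int m + u\<rfloor> = m"
      using assms by linarith
    then have "of_int m + u \<notin> \<int>"
      using assms by (metis add_cancel_right_right less_irrefl of_int_floor)
    then have "\<beta> (of_int m + u) < \<beta> (of_int m + u + 1)"
      by (rule less_succ)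
    also have "\<dots> \<le> \<beta> (of_int n + u)"
      using \<open>m < n\<close> by (intro monoD[OF mono]) simp
    finally show "bids u m < bids u n"
      by (simp add: bids_def)
  qed
  then show ?thesis
    by (simp add: strategy_def bids_def pos)
qed

lemma ex_stops_at_bids:
  assumes "0 < u" "u < 1" "0 < T"
  shows "\<exists>n. stops_at (bids u) T n"
proof -
  obtain x where "\<beta> x < T"
    using ex_less[OF \<open>0 < T\<close>] by blast
  moreover have "bids u (\<lfloor>x\<rfloor> - 1) \<le> \<beta> x"
    unfolding bids_def using assms by (intro monoD[OF mono]) linarith
  moreover obtain y where "T \<le> \<beta> y"
    using ex_ge by blast
  moreover have "\<beta> y \<le> bids u \<lceil>y\<rceil>"
    unfolding bids_def using assms by (intro monoD[OF mono]) linarith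
  moreover have "mono (bids u)"
    using strategy_bids[OF assms(1,2)] by (simp add: strategy_def strict_mono_mono)
  ultimately show ?thesis
    using ex_stops_at[of "bids u" "\<lfloor>x\<rfloor> - 1" T "\<lceil>y\<rceil>"] by simp
qed

lemma measurable_bids [measurable]: "bids \<in> borel \<rightarrow>\<^sub>M Pi\<^sub>M UNIV (\<lambda>_. borel)"
proof -
  have "(\<lambda>u. \<lambda>n\<in>UNIV. \<beta> (of_int n + u)) \<in> borel \<rightarrow>\<^sub>M Pi\<^sub>M UNIV (\<lambda>_. borel)"
    by (rule measurable_restrict) measurable
  moreover have "bids = (\<lambda>u. \<lambda>n\<in>UNIV. \<beta> (of_int n + u))"
    by (intro ext) (simp add: bids_def)
  ultimately show ?thesis by simp
qed

lemma measurable_bids_uniform: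
  "bids \<in> uniform_measure lborel {0<..<1} \<rightarrow>\<^sub>M Pi\<^sub>M UNIV (\<lambda>_. borel)"
proof -
  have "sets (uniform_measure lborel {0<..<1::real}) = sets borel" by simp
  from measurable_cong_sets[OF this refl] show ?thesis
    using measurable_bids by blast
qed

lemma randomized_strategy_mixture: "randomized_strategy mixture"
  unfolding randomized_strategy_def
proof (intro conjI)
  show "prob_space mixture"
    unfolding mixture_def
    by (intro prob_space.prob_space_distr prob_space_uniform_measure measurable_bids_uniform) auto
  show "sets mixture = sets (Pi\<^sub>M UNIV (\<lambda>_. borel))"
    by (simp add: mixture_def)
  have "AE u in uniform_measure lborel {0<..<1}. strategy (bids u)"
    using strategy_bids by (intro AE_uniform_measureI) auto
  then show "AE b in mixture. strategy b"
    unfolding mixture_def using measurable_bids_uniform measurable_strategy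
    by (subst AE_distr_iff) (auto simp: pred_def)
qed

lemma cost_bids:
  assumes "0 < u" "u < 1" "0 < T"
  shows "cost (bids u) T
    = (\<integral>\<^sup>+n. ennreal (\<beta> (of_int n + u)) * indicator {x. \<beta> (x - 1) < T} (of_int n + u)
        \<partial>count_space UNIV)"
proof -
  obtain n where stops: "stops_at (bids u) T n"
    using ex_stops_at_bids[OF assms] by blast
  have "\<beta> (of_int m + u - 1) < T \<longleftrightarrow> m \<le> n" for m
  proof -
    have "bids u (m - 1) < T \<longleftrightarrow> m \<le> n"
      using stops strategy_bids[OF assms(1,2)] unfolding stops_at_def strategy_def
      by (metis leD leI order.strict_trans1 strict_mono_less_eq zle_diff1_eq)
    then show ?thesis by (simp add: bids_def algebra_simps)
  qed
  then show ?thesis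
    by (simp add: cost_eq_nn_integral[OF stops] nn_integral_count_space_indicator bids_def
        indicator_def)
qed

lemma exp_cost_mixture:
  assumes "0 < T"
  shows "exp_cost mixture T = (\<integral>\<^sup>+x\<in>{x. \<beta> (x - 1) < T}. ennreal (\<beta> x) \<partial>lborel)"
proof -
  have "exp_cost mixture T = (\<integral>\<^sup>+u. cost (bids u) T \<partial>uniform_measure lborel {0<..<1})"
    unfolding exp_cost_def mixture_def
    by (rule nn_integral_distr[OF measurable_bids_uniform]) (simp add: measurable_cost)
  also have "\<dots> = (\<integral>\<^sup>+u\<in>{0<..<1}. cost (bids u) T \<partial>lborel)"
    using measurable_compose[OF measurable_bids measurable_cost]
    by (subst nn_integral_uniform_measure) (simp_all add: divide_ennreal_def)
  also have "\<dots> = (\<integral>\<^sup>+u\<in>{0<..<1}. (\<integral>\<^sup>+n. ennreal (\<beta> (of_int n + u))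
      * indicator {x. \<beta> (x - 1) < T} (of_int n + u) \<partial>count_space UNIV) \<partial>lborel)"
    by (intro nn_integral_cong) (auto simp: cost_bids assms split: split_indicator)
  also have "\<dots> = (\<integral>\<^sup>+x\<in>{x. \<beta> (x - 1) < T}. ennreal (\<beta> x) \<partial>lborel)"
    by (rule nn_integral_lborel_eq_unit_shifts[symmetric]) measurable
  finally show ?thesis .
qed

lemma exp_cost_mixture_le:
  assumes "0 < T" "0 \<le> \<rho>"
    and integral_le: "\<And>a t. integral {a..t+1} \<beta> \<le> \<rho> * \<beta> t"
    and curve_le: "\<And>t. \<beta> t < T \<Longrightarrow> \<beta> t \<le> c"
  shows "exp_cost mixture T \<le> ennreal (\<rho> * c)"
proof -
  define region where "region = {x. \<beta> (x - 1) < T}"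
  obtain x0 where "\<beta> (x0 + 1 - 1) < T"
    using ex_less[OF \<open>0 < T\<close>] by auto
  then have "region \<noteq> {}"
    unfolding region_def by blast
  obtain y where "T \<le> \<beta> y"
    using ex_ge by blast
  have "x \<le> y + 1" if "x \<in> region" for x
    using that \<open>T \<le> \<beta> y\<close> monoD[OF mono, of y "x - 1"] by (fastforce simp: region_def)
  then have "bdd_above region"
    by (auto simp: bdd_above_def)
  have "integral {a..b} \<beta> \<le> \<rho> * c" if "b < Sup region" for a b
  proof -
    obtain x where "x \<in> region" "b < x"
      using \<open>b < Sup region\<close> \<open>region \<noteq> {}\<close> by (rule less_cSupE)
    then have "\<beta> (b - 1) < T"
      using monoD[OF mono, of "b - 1" "x - 1"] by (simp add: region_def)
    then have "\<rho> * \<beta> (b - 1) \<le> \<rho> * c"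
      using curve_le \<open>0 \<le> \<rho>\<close> by (intro mult_left_mono)
    then show ?thesis
      using integral_le[of a "b - 1"] by simp
  qed
  then have bound: "(\<integral>\<^sup>+x\<in>{..Sup region}. ennreal (\<beta> x) \<partial>lborel) \<le> ennreal (\<rho> * c)"
    by (intro set_nn_integral_atMost_le borel_measurable_curve integrable_curve)
      (auto simp: pos less_imp_le)
  have "exp_cost mixture T = (\<integral>\<^sup>+x\<in>region. ennreal (\<beta> x) \<partial>lborel)"
    unfolding region_def by (rule exp_cost_mixture[OF \<open>0 < T\<close>])
  also have "\<dots> \<le> (\<integral>\<^sup>+x\<in>{..Sup region}. ennreal (\<beta> x) \<partial>lborel)"
    using cSup_upper[OF _ \<open>bdd_above region\<close>] by (intro nn_set_integral_set_mono) auto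
  finally show ?thesis
    using bound by simp
qed

lemma robust_mixture:
  assumes "0 \<le> \<rho>" "\<And>a t. integral {a..t+1} \<beta> \<le> \<rho> * \<beta> t"
  shows "robust mixture \<rho>"
  unfolding robust_def using assms by (intro allI impI exp_cost_mixture_le) auto

lemma consistent_mixture:
  assumes "0 \<le> \<rho>" "\<And>a t. integral {a..t+1} \<beta> \<le> \<rho> * \<beta> t" "\<And>t. \<beta> t < 1 \<Longrightarrow> \<beta> t \<le> c"
  shows "consistent mixture (\<rho> * c)"
  unfolding consistent_def using assms by (intro exp_cost_mixture_le) auto

end

section \<open>The optimal bidding curve\<close>

text \<open>The solution f of \<open>f' = s * exp (- s) * g\<close> on the unit interval that, followed by g on the next
  one, has no component along \<open>exp (s * t)\<close>.\<close>
definition left_extension :: "real \<Rightarrow> (real \<Rightarrow> real) \<Rightarrow> real \<Rightarrow> real" where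
  "left_extension s g u
    = s * integral {0..1} (\<lambda>v. exp (- s * v) * g v) - s * exp (- s) * integral {u..1} g"

context
  fixes s :: real and g :: "real \<Rightarrow> real"
  assumes continuous: "continuous_on {0..1} g"
begin

lemma left_extension_one: "left_extension s g 1 = s * integral {0..1} (\<lambda>v. exp (- s * v) * g v)"
  by (simp add: left_extension_def)

lemma left_extension_has_derivative:
  assumes "u \<in> {0..1}"
  shows "(left_extension s g has_real_derivative s * exp (- s) * g u) (at u within {0..1})"
  unfolding left_extension_def
  by (auto intro!: derivative_eq_intros integral_has_real_derivative' continuous assms)

lemma continuous_on_left_extension: "continuous_on {0..1} (left_extension s g)"
  using left_extension_has_derivative by (meson DERIV_continuous_on)

lemma left_extension_increment:
  assumes "0 \<le> u" "u \<le> v" "v \<le> 1"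
  shows "left_extension s g v - left_extension s g u = s * exp (- s) * integral {u..v} g"
proof -
  have "integral {u..1} g = integral {u..v} g + integral {v..1} g"
    using assms
    by (intro Henstock_Kurzweil_Integration.integral_combine[symmetric]
        integrable_continuous_interval continuous_on_subset[OF continuous]) auto
  then show ?thesis
    by (simp add: left_extension_def algebra_simps)
qed

lemma left_extension_pos:
  assumes "0 < s" and pos: "\<And>u. u \<in> {0..1} \<Longrightarrow> 0 < g u" and "u \<in> {0..1}"
  shows "0 < left_extension s g u"
proof -
  have "integral {0..1} (\<lambda>v. exp (- s) * g v) < integral {0..1} (\<lambda>v. exp (- s * v) * g v)"
    using \<open>0 < s\<close> pos
    by (intro integral_less_real continuous_intros continuous mult_strict_right_mono) auto
  then have "s * (exp (- s) * integral {0..1} g) < s * integral {0..1} (\<lambda>v. exp (- s * v) * g v)"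
    using \<open>0 < s\<close> by (intro mult_strict_left_mono) auto
  then have "0 < left_extension s g 0"
    by (simp add: left_extension_def)
  moreover have "0 \<le> integral {0..u} g"
    using assms by (intro integral_nonneg integrable_continuous_interval
        continuous_on_subset[OF continuous]) (auto intro: less_imp_le)
  then have "0 \<le> s * exp (- s) * integral {0..u} g"
    using \<open>0 < s\<close> by simp
  then have "left_extension s g 0 \<le> left_extension s g u"
    using left_extension_increment[of 0 u] assms by simp
  ultimately show ?thesis by simp
qed

end

lemma left_extension_left_extension_one:
  assumes "continuous_on {0..1} g"
  shows "left_extension s (left_extension s g) 1 = left_extension s g 0"
proof -
  let ?f = "left_extension s g"
  have cont: "continuous_on {0..1} ?f"
    using assms by (rule continuous_on_left_extension)
  have "((\<lambda>v. exp (- s * v) * (s * exp (- s) * g v) - s * exp (- s * v) * ?f v)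
      has_integral exp (- s * 1) * ?f 1 - exp (- s * 0) * ?f 0) {0..1}"
    by (intro fundamental_theorem_of_calculus)
      (auto simp flip: has_real_derivative_iff_has_vector_derivative
        intro!: derivative_eq_intros left_extension_has_derivative[OF assms])
  then have "exp (- s) * ?f 1 - ?f 0
      = integral {0..1} (\<lambda>v. exp (- s * v) * (s * exp (- s) * g v) - s * exp (- s * v) * ?f v)"
    by (simp add: integral_unique)
  also have "\<dots> = integral {0..1} (\<lambda>v. exp (- s * v) * (s * exp (- s) * g v))
      - integral {0..1} (\<lambda>v. s * exp (- s * v) * ?f v)"
    by (intro Henstock_Kurzweil_Integration.integral_diff integrable_continuous_interval
        continuous_intros assms cont)
  also have "integral {0..1} (\<lambda>v. s * exp (- s * v) * ?f v) = left_extension s ?f 1"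
    using left_extension_one[OF cont, of s] by (simp add: mult.assoc)
  also have "integral {0..1} (\<lambda>v. exp (- s * v) * (s * exp (- s) * g v)) = exp (- s) * ?f 1"
  proof -
    have "integral {0..1} (\<lambda>v. exp (- s * v) * (s * exp (- s) * g v))
        = integral {0..1} (\<lambda>v. exp (- s) * s * (exp (- s * v) * g v))"
      by (simp add: ac_simps)
    then show ?thesis
      using left_extension_one[OF assms, of s] by simp
  qed
  finally show ?thesis by simp
qed

lemma rho_pos: "0 < s \<Longrightarrow> 0 < rho s"
  by (simp add: rho_def)

text \<open>The value at 1 of the left extension of \<open>\<lambda>u. exp (s * max 0 (u - p))\<close>.\<close>
definition jump_height :: "real \<Rightarrow> real \<Rightarrow> real" where
  "jump_height s p = 1 - exp (- s * p) + s * (1 - p) * exp (- s * p)"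

locale kinked_curve =
  fixes s p :: real
  assumes s_pos: "0 < s" and p_bounds: "0 \<le> p" "p \<le> 1"
    and height_le: "jump_height s p \<le> exp (- s * p)"
begin

definition piece :: "nat \<Rightarrow> real \<Rightarrow> real" where
  "piece k = (left_extension s ^^ k) (\<lambda>u. exp (s * max 0 (u - p)))"

text \<open>Piece k on \<open>(-k, 1 - k]\<close>; the curve is left-continuous, and jumps to 1 after 0.\<close>
definition curve :: "real \<Rightarrow> real" where
  "curve t = piece (nat (1 - \<lceil>t\<rceil>)) (t + real (nat (1 - \<lceil>t\<rceil>)))"

lemma piece_0: "piece 0 u = exp (s * max 0 (u - p))"
  by (simp add: piece_def)

lemma piece_Suc: "piece (Suc k) = left_extension s (piece k)"
  by (simp add: piece_def)

lemma continuous_on_piece: "continuous_on {0..1} (piece k)"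
proof (induction k)
  case 0
  show ?case by (auto simp: piece_def intro!: continuous_intros)
next
  case (Suc k)
  then show ?case unfolding piece_Suc by (rule continuous_on_left_extension)
qed

lemma piece_pos: "u \<in> {0..1} \<Longrightarrow> 0 < piece k u"
proof (induction k arbitrary: u)
  case 0
  show ?case by (simp add: piece_0)
next
  case (Suc k)
  then show ?case
    unfolding piece_Suc using continuous_on_piece s_pos by (intro left_extension_pos)
qed

lemma piece_increment:
  "0 \<le> u \<Longrightarrow> u \<le> v \<Longrightarrow> v \<le> 1 \<Longrightarrow> rho s * (piece (Suc k) v - piece (Suc k) u) = integral {u..v} (piece k)"
  using s_pos
  by (simp add: piece_Suc left_extension_increment[OF continuous_on_piece] rho_def exp_minus)

lemma piece_Suc_Suc_one: "piece (Suc (Suc k)) 1 = piece (Suc k) 0"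
  by (simp add: piece_Suc left_extension_left_extension_one[OF continuous_on_piece])

lemma curve_minus_nat:
  assumes "0 < u" "u \<le> 1"
  shows "curve (u - real k) = piece k u"
proof -
  have "\<lceil>u - real k\<rceil> = 1 - int k"
    using assms by linarith
  then show ?thesis by (simp add: curve_def)
qed

lemma curve_minus_Suc:
  assumes "0 \<le> u" "u \<le> 1"
  shows "curve (u - real (Suc k)) = piece (Suc k) u"
proof (cases "u = 0")
  case True
  then show ?thesis
    using curve_minus_nat[of 1 "Suc (Suc k)"] by (simp add: piece_Suc_Suc_one)
qed (use assms curve_minus_nat[of u "Suc k"] in \<open>simp del: of_nat_Suc\<close>)

lemma curve_after_zero:
  assumes "0 < t"
  shows "curve t = exp (s * max 0 (t - p))"
proof -
  have "nat (1 - \<lceil>t\<rceil>) = 0"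
    using assms by simp
  then show ?thesis
    unfolding curve_def by (simp add: piece_0)
qed

lemma curve_pos: "0 < curve t"
proof -
  define k where "k = nat (1 - \<lceil>t\<rceil>)"
  show ?thesis
  proof (cases "0 < t")
    case False
    then have "t + real k \<in> {0..1}"
      unfolding k_def by (auto simp: of_nat_nat) linarith+
    then show ?thesis
      unfolding curve_def k_def[symmetric] by (rule piece_pos)
  qed (simp add: curve_after_zero)
qed

lemma curve_zero: "curve 0 = jump_height s p"
proof -
  have integrable: "(\<lambda>v. exp (- s * v) * piece 0 v) integrable_on {a..b}" if "0 \<le> a" "b \<le> 1" for a b
    using that by (auto intro!: integrable_continuous_interval continuous_intros
        continuous_on_subset[OF continuous_on_piece])
  have "integral {0..1} (\<lambda>v. exp (- s * v) * piece 0 v)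
      = integral {0..p} (\<lambda>v. exp (- s * v) * piece 0 v)
      + integral {p..1} (\<lambda>v. exp (- s * v) * piece 0 v)"
    using p_bounds by (intro Henstock_Kurzweil_Integration.integral_combine[symmetric] integrable) auto
  also have "integral {0..p} (\<lambda>v. exp (- s * v) * piece 0 v) = integral {0..p} (\<lambda>v. exp (- s * v))"
    by (intro Henstock_Kurzweil_Integration.integral_cong) (auto simp: piece_0)
  also have "\<dots> = (1 - exp (- s * p)) / s"
    using integral_exp_neg[of 0 p s] p_bounds s_pos by simp
  also have "integral {p..1} (\<lambda>v. exp (- s * v) * piece 0 v) = integral {p..1} (\<lambda>_. exp (- s * p))"
    by (intro Henstock_Kurzweil_Integration.integral_cong)
      (auto simp: piece_0 mult_exp_exp algebra_simps)
  finally have "piece 1 1 = jump_height s p"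
    using s_pos p_bounds
    by (simp add: piece_Suc left_extension_one[OF continuous_on_piece] jump_height_def field_simps)
  then show ?thesis
    using curve_minus_nat[of 1 1] by simp
qed

lemma height_le_one: "jump_height s p \<le> 1"
proof -
  have "exp (- s * p) \<le> 1"
    using s_pos p_bounds by simp
  then show ?thesis
    using height_le by linarith
qed

lemma curve_has_integral_cell:
  assumes "0 \<le> u" "u \<le> v" "v \<le> 1"
  shows "(curve has_integral rho s * (curve (v - real (Suc k)) - curve (u - real (Suc k))))
    {u - real k..v - real k}"
proof (rule has_integral_spike_finite[where S = "{- real k}"])
  have "(piece k has_integral integral {u..v} (piece k)) {u..v}"
    using assms by (intro integrable_integral integrable_continuous_interval
        continuous_on_subset[OF continuous_on_piece]) auto
  from has_integral_shift_real_ivl[OF this, of "real k"]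
  show "((\<lambda>x. piece k (x + real k)) has_integral
      rho s * (curve (v - real (Suc k)) - curve (u - real (Suc k)))) {u - real k..v - real k}"
    using assms curve_minus_Suc[of u k] curve_minus_Suc[of v k] by (simp only: piece_increment)
  fix x assume "x \<in> {u - real k..v - real k} - {- real k}"
  then show "curve x = piece k (x + real k)"
    using curve_minus_nat[of "x + real k" k] assms by simp
qed simp

lemma curve_has_integral:
  assumes "a \<le> b" "b \<le> 0"
  shows "(curve has_integral rho s * (curve b - curve a)) {a+1..b+1}"
proof -
  have "(curve has_integral rho s * (curve b - curve a)) {a+1..b+1}"
    if "- real n \<le> a" "a \<le> b" "b \<le> 0" for n a b
    using that
  proof (induction n arbitrary: a b)
    case 0
    then have "a = 0" "b = 0" by auto
    then show ?case by (simp add: has_integral_refl)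
  next
    case (Suc n)
    have cell: "(curve has_integral rho s * (curve c - curve a)) {a+1..c+1}"
      if "a \<le> c" "c \<le> - real n" for c
      using curve_has_integral_cell[of "a + real (Suc n)" "c + real (Suc n)" n] that Suc.prems(1)
      by (simp add: algebra_simps)
    consider (right) "- real n \<le> a" | (left) "b \<le> - real n" | (across) "a \<le> - real n" "- real n \<le> b"
      by linarith
    then show ?case
    proof cases
      case across
      then have "(curve has_integral
          rho s * (curve (- real n) - curve a) + rho s * (curve b - curve (- real n))) {a+1..b+1}"
        using Suc.prems by (intro has_integral_combine[OF _ _ cell Suc.IH]) auto
      then show ?thesis by (simp add: algebra_simps)
    qed (use Suc cell in auto)
  qed
  moreover obtain n :: nat where "- a \<le> real n"
    using real_arch_simple by blast
  ultimately show ?thesis using assms by (metis minus_le_iff)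
qed

lemma mono_curve: "mono curve"
proof (rule monoI)
  have before_zero: "curve a \<le> curve b" if "a \<le> b" "b \<le> 0" for a b
  proof -
    have "0 \<le> rho s * (curve b - curve a)"
      using curve_has_integral[OF that]
      by (rule has_integral_nonneg) (simp add: curve_pos less_imp_le)
    then show ?thesis using rho_pos[OF s_pos] by (simp add: zero_le_mult_iff)
  qed
  fix a b :: real assume "a \<le> b"
  consider (before) "b \<le> 0" | (across) "a \<le> 0" "0 < b" | (after) "0 < a"
    by linarith
  then show "curve a \<le> curve b"
  proof cases
    case before
    with \<open>a \<le> b\<close> show ?thesis by (rule before_zero)
  next
    case across
    have "curve a \<le> jump_height s p"
      using before_zero[of a 0] across by (simp add: curve_zero)
    also have "\<dots> \<le> 1"
      by (rule height_le_one)
    also have "1 \<le> curve b"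
      using across s_pos by (simp add: curve_after_zero)
    finally show ?thesis .
  next
    case after
    then show ?thesis
      using \<open>a \<le> b\<close> s_pos by (auto simp: curve_after_zero intro!: mult_left_mono)
  qed
qed

lemma curve_increment_ge:
  assumes "a \<le> b" "b \<le> 0"
  shows "(b - a) * curve (a + 1) \<le> rho s * (curve b - curve a)"
proof (rule has_integral_le)
  show "((\<lambda>_. curve (a + 1)) has_integral (b - a) * curve (a + 1)) {a+1..b+1}"
    using has_integral_const_real[of "curve (a + 1)" "a + 1" "b + 1"] assms by simp
  show "(curve has_integral rho s * (curve b - curve a)) {a+1..b+1}"
    using assms by (rule curve_has_integral)
qed (auto intro: monoD[OF mono_curve])

lemma curve_less:
  assumes "a < b" "b \<le> 0"
  shows "curve a < curve b"
proof -
  have "0 < (b - a) * curve (a + 1)"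
    using assms curve_pos by simp
  then have "0 < rho s * (curve b - curve a)"
    using curve_increment_ge[of a b] assms by linarith
  then show ?thesis using rho_pos[OF s_pos] by (simp add: zero_less_mult_iff)
qed

lemma curve_less_succ:
  assumes "x \<notin> \<int>"
  shows "curve x < curve (x + 1)"
proof -
  have "x \<noteq> 0"
    using assms by auto
  then consider (before) "x + 1 \<le> 0" | (across) "x < 0" "0 < x + 1" | (after) "0 < x"
    by linarith
  then show ?thesis
  proof cases
    case before
    then show ?thesis by (simp add: curve_less)
  next
    case across
    have "curve x < curve 0"
      using across by (simp add: curve_less)
    also have "\<dots> \<le> curve (x + 1)"
      using across by (intro monoD[OF mono_curve]) simp
    finally show ?thesis .
  next
    case after
    then have "max 0 (x - p) < max 0 (x + 1 - p)"
      using p_bounds by (auto simp: max_def)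
    then show ?thesis using after s_pos by (simp add: curve_after_zero)
  qed
qed

lemma ex_curve_less:
  assumes "0 < T"
  shows "\<exists>x. curve x < T"
proof -
  obtain n :: nat where n_gt: "rho s * curve 0 / T < real n"
    using reals_Archimedean2 by blast
  have "real n * curve (- real n) \<le> real n * curve (- real n + 1)"
    by (intro mult_left_mono monoD[OF mono_curve]) auto
  also have "\<dots> \<le> rho s * (curve 0 - curve (- real n))"
    using curve_increment_ge[of "- real n" 0] by simp
  also have "\<dots> \<le> rho s * curve 0"
    using curve_pos[of "- real n"] rho_pos[OF s_pos] by (intro mult_left_mono) auto
  also have "\<dots> < real n * T"
    using n_gt assms by (subst (asm) pos_divide_less_eq)
  finally show ?thesis
    by (metis mult_less_cancel_left_pos of_nat_0_le_iff mult_left_less_imp_less)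
qed

lemma ex_curve_ge: "\<exists>x. T \<le> curve x"
proof -
  define x where "x = p + \<bar>T\<bar> / s + 1"
  have "s * (x - p) = \<bar>T\<bar> + s"
    using s_pos by (simp add: x_def distrib_left)
  then have "T \<le> exp (s * (x - p))"
    using s_pos exp_ge_add_one_self[of "s * (x - p)"] by linarith
  moreover have "p < x"
    using s_pos by (simp add: x_def add_nonneg_pos)
  then have "curve x = exp (s * (x - p))"
    using p_bounds by (simp add: curve_after_zero)
  ultimately show ?thesis by metis
qed

sublocale bidding_curve curve
  using curve_pos mono_curve curve_less_succ ex_curve_less ex_curve_ge by unfold_locales

lemma curve_has_integral_from_one:
  assumes "0 \<le> t"
  shows "(curve has_integral (exp (s * (t + 1 - p)) - exp (s * (1 - p))) / s) {1..t+1}"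
proof (rule has_integral_eq)
  have "((\<lambda>x. exp (s * (x - p))) has_integral
      exp (s * (t + 1 - p)) / s - exp (s * (1 - p)) / s) {1..t+1}"
    using assms s_pos by (intro fundamental_theorem_of_calculus)
      (auto simp flip: has_real_derivative_iff_has_vector_derivative intro!: derivative_eq_intros)
  then show "((\<lambda>x. exp (s * (x - p))) has_integral
      (exp (s * (t + 1 - p)) - exp (s * (1 - p))) / s) {1..t+1}"
    by (simp add: diff_divide_distrib)
  show "exp (s * (x - p)) = curve x" if "x \<in> {1..t+1}" for x
    using that p_bounds by (simp add: curve_after_zero)
qed

lemma integral_curve_le_before_zero:
  assumes "t \<le> 0"
  shows "integral {a..t+1} curve \<le> rho s * curve t"
proof (cases "a \<le> t + 1")
  case True
  then have "integral {a..t+1} curve = rho s * (curve t - curve (a - 1))"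
    using integral_unique[OF curve_has_integral[of "a - 1" t]] assms by simp
  also have "\<dots> \<le> rho s * curve t"
    using curve_pos[of "a - 1"] rho_pos[OF s_pos] by (intro mult_left_mono) auto
  finally show ?thesis .
next
  case False
  then show ?thesis
    using curve_pos[of t] rho_pos[OF s_pos] by simp
qed

lemma integral_curve_le: "integral {a..t+1} curve \<le> rho s * curve t"
proof (cases "t \<le> 0")
  case False
  define c where "c = min a 1"
  have "integral {a..t+1} curve \<le> integral {c..t+1} curve"
    by (intro integral_subset_le integrable_curve) (auto simp: c_def less_imp_le pos)
  also have "\<dots> = integral {c..1} curve + integral {1..t+1} curve"
    using False by (intro Henstock_Kurzweil_Integration.integral_combine[symmetric] integrable_curve)
      (auto simp: c_def)
  also have "integral {1..t+1} curve = exp (s * (t + 1 - p)) / s - exp (s * (1 - p)) / s"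
    using integral_unique[OF curve_has_integral_from_one[of t]] False
    by (simp add: diff_divide_distrib)
  also have "integral {c..1} curve \<le> exp (s * (1 - p)) / s"
  proof -
    have "integral {c..1} curve \<le> rho s * jump_height s p"
      using integral_curve_le_before_zero[of 0 c] by (simp add: curve_zero)
    also have "\<dots> \<le> rho s * exp (- s * p)"
      using height_le rho_pos[OF s_pos] by (intro mult_left_mono) auto
    also have "\<dots> = exp (s * (1 - p)) / s"
      by (simp add: rho_def mult_exp_exp algebra_simps)
    finally show ?thesis .
  qed
  also have "exp (s * (1 - p)) / s + (exp (s * (t + 1 - p)) / s - exp (s * (1 - p)) / s)
      = rho s * exp (s * (t - p))"
    by (simp add: rho_def mult_exp_exp algebra_simps)
  also have "\<dots> \<le> rho s * curve t"
    using False s_pos rho_pos[OF s_pos] by (intro mult_left_mono) (auto simp: curve_after_zero)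
  finally show ?thesis by simp
qed (rule integral_curve_le_before_zero)

lemma robust_curve: "robust mixture (rho s)"
  using rho_pos[OF s_pos] by (intro robust_mixture integral_curve_le) simp

lemma consistent_curve: "consistent mixture (rho s * jump_height s p)"
proof (rule consistent_mixture[OF _ integral_curve_le])
  fix t assume "curve t < 1"
  then have "t \<le> 0"
    using s_pos by (cases "0 < t") (auto simp: curve_after_zero mult_less_0_iff)
  then show "curve t \<le> jump_height s p"
    using monoD[OF mono_curve, of t 0] by (simp add: curve_zero)
qed (use rho_pos[OF s_pos] in simp)

end

section \<open>The optimal trade-off\<close>

lemma mult_2_minus_ln_less:
  fixes u v :: real
  assumes "1 \<le> u" "u < v" "v \<le> exp 1"
  shows "u * (2 - ln u) < v * (2 - ln v)"
proof (rule DERIV_pos_imp_increasing_open[OF \<open>u < v\<close>])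
  fix w assume between: "u < w" "w < v"
  then have "((\<lambda>x. x * (2 - ln x)) has_real_derivative 1 - ln w) (at w)"
    using assms by (auto intro!: derivative_eq_intros simp: field_simps)
  moreover have "ln w < ln (exp 1)"
    using between assms by (intro ln_less_cancel_iff[THEN iffD2]) auto
  ultimately show "\<exists>y. ((\<lambda>x. x * (2 - ln x)) has_real_derivative y) (at w) \<and> 0 < y"
    by (intro exI[of _ "1 - ln w"]) simp
next
  show "continuous_on {u..v} (\<lambda>x. x * (2 - ln x))"
    using assms by (intro continuous_intros) auto
qed

lemma xi_solution:
  assumes "ln 2 \<le> s" "s \<le> 1"
  shows "1 \<le> xi s" "xi s \<le> exp s" "xi s * (2 - ln (xi s)) = exp s"
proof -
  have "2 \<le> exp s"
    using assms by (metis exp_le_cancel_iff exp_ln zero_less_numeral)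
  moreover have "exp s \<le> exp s * (2 - ln (exp s))"
    using assms by simp
  moreover have "0 \<le> s"
    using assms ln_ge_zero[of "2::real"] by linarith
  moreover have "continuous_on {1..exp s} (\<lambda>x. x * (2 - ln x))"
    by (intro continuous_intros) auto
  ultimately obtain x where x_solves: "1 \<le> x" "x \<le> exp s" "x * (2 - ln x) = exp s"
    using IVT'[of "\<lambda>x. x * (2 - ln x)" 1 "exp s" "exp s"] by auto
  have "xi s = x"
    unfolding xi_def
  proof (rule the_equality)
    show "1 \<le> x \<and> x \<le> exp 1 \<and> x * (2 - ln x) = exp s"
      using x_solves assms by (auto intro: order.trans)
    show "z = x" if "1 \<le> z \<and> z \<le> exp 1 \<and> z * (2 - ln z) = exp s" for z
      using that x_solves assms mult_2_minus_ln_less[of z x] mult_2_minus_ln_less[of x z]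
      by (cases z x rule: linorder_cases) (auto dest: order.trans)
  qed
  then show "1 \<le> xi s" "xi s \<le> exp s" "xi s * (2 - ln (xi s)) = exp s"
    using x_solves by auto
qed

text \<open>Chosen so that \<open>xi s = exp (s * (1 - kink s))\<close> when \<open>ln 2 \<le> s\<close>.\<close>
definition kink :: "real \<Rightarrow> real" where
  "kink s = (if s < ln 2 then 1 else 1 - ln (xi s) / s)"

context
  fixes s :: real
  assumes s_bounds: "0 < s" "s \<le> 1"
begin

lemma exp_kink:
  assumes "ln 2 \<le> s"
  shows "exp (- s * kink s) = xi s / exp s"
proof -
  have "- s * kink s = ln (xi s) - s"
    using assms s_bounds by (simp add: kink_def right_diff_distrib)
  then show ?thesis
    using xi_solution(1)[of s] assms s_bounds by (simp add: exp_diff)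
qed

lemma kink_bounds: "0 \<le> kink s" "kink s \<le> 1"
proof -
  have "ln (xi s) \<le> s" "0 \<le> ln (xi s)" if "\<not> s < ln 2"
    using that xi_solution[of s] s_bounds ln_le_cancel_iff[of "xi s" "exp s"] by auto
  then show "0 \<le> kink s" "kink s \<le> 1"
    using s_bounds by (auto simp: kink_def field_simps)
qed

lemma chi_eq_jump_height: "chi s = rho s * jump_height s (kink s)"
proof (cases "s < ln 2")
  case True
  then show ?thesis
    by (simp add: chi_def jump_height_def kink_def right_diff_distrib diff_divide_distrib
        rho_def exp_minus)
next
  case False
  have "s * (1 - kink s) = ln (xi s)"
    using False s_bounds by (simp add: kink_def)
  then have "exp s * jump_height s (kink s)
      = exp s * (1 - xi s / exp s + ln (xi s) * (xi s / exp s))"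
    using exp_kink[OF leI[OF False]] by (simp only: jump_height_def)
  also have "\<dots> = exp s - xi s + ln (xi s) * xi s"
    by (simp add: field_simps)
  also have "\<dots> = xi s"
    using xi_solution(3)[of s] False s_bounds by (simp add: algebra_simps)
  finally show ?thesis
    using False by (simp add: chi_def rho_def)
qed

lemma chi_le: "chi s \<le> rho s * exp (- s * kink s)"
proof (cases "s < ln 2")
  case True
  then have "exp s < exp (ln 2)"
    by (subst exp_less_cancel_iff)
  then show ?thesis
    using True s_bounds by (simp add: chi_def kink_def rho_def exp_minus field_simps)
next
  case False
  then show ?thesis
    unfolding exp_kink[OF leI[OF False]] by (simp add: chi_def rho_def)
qed

lemma chi_mult_eq: "chi s * (1 - s * (1 - kink s)) = rho s * (1 - exp (- s * kink s))"
proof -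
  have at_kink: "(1 - kink s) * chi s = (1 - kink s) * (rho s * exp (- s * kink s))"
  proof (cases "s < ln 2")
    case False
    then show ?thesis unfolding exp_kink[OF leI[OF False]] by (simp add: chi_def rho_def)
  qed (simp add: kink_def)
  have "chi s * (1 - s * (1 - kink s)) = chi s - s * ((1 - kink s) * chi s)"
    by (simp add: algebra_simps)
  also have "\<dots> = chi s - s * ((1 - kink s) * (rho s * exp (- s * kink s)))"
    unfolding at_kink ..
  also have "\<dots> = rho s * (1 - exp (- s * kink s))"
    unfolding chi_eq_jump_height jump_height_def by (simp add: algebra_simps)
  finally show ?thesis .
qed

lemma kinked_curve_kink: "kinked_curve s (kink s)"
proof
  show "jump_height s (kink s) \<le> exp (- s * kink s)"
    using chi_le rho_pos[OF s_bounds(1)] unfolding chi_eq_jump_height by simp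
qed (use s_bounds kink_bounds in auto)

end

theorem theorem1:
  fixes s :: real
  assumes "0 < s" and "s \<le> 1"
  shows "(\<exists>M. randomized_strategy M \<and> robust M (rho s) \<and> consistent M (chi s))
    \<and> \<not> (\<exists>M \<rho>'. \<rho>' < rho s \<and> randomized_strategy M \<and> robust M \<rho>' \<and> consistent M (chi s))"
proof (intro conjI notI)
  interpret kinked_curve s "kink s"
    using assms by (rule kinked_curve_kink)
  show "\<exists>M. randomized_strategy M \<and> robust M (rho s) \<and> consistent M (chi s)"
    unfolding chi_eq_jump_height[OF assms]
    using randomized_strategy_mixture robust_curve consistent_curve by blast
next
  assume "\<exists>M \<rho>'. \<rho>' < rho s \<and> randomized_strategy M \<and> robust M \<rho>' \<and> consistent M (chi s)"
  then obtain M \<rho>' where "\<rho>' < rho s" and consistent: "consistent M (chi s)"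
    and "robust_strategy M \<rho>'"
    by (auto simp: robust_strategy_def)
  then interpret robust_strategy M \<rho>' by simp
  have "mean_sum (beyond 1) \<le> chi s"
    using consistent by (intro mean_sum_beyond_le_if_exp_cost_le) (auto simp: consistent_def)
  moreover have "0 \<le> 1 - s * (1 - kink s)"
    using assms kink_bounds[OF assms] mult_mono[of s 1 "1 - kink s" 1] by simp
  ultimately have "mean_sum (beyond 1) * (1 - s * (1 - kink s)) \<le> rho s * (1 - exp (- s * kink s))"
    unfolding chi_mult_eq[OF assms, symmetric] by (rule mult_right_mono)
  then show False
    using mean_sum_beyond_one_gt[OF assms \<open>\<rho>' < rho s\<close> kink_bounds[OF assms]] by simp
qed

end
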